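(* Fix $\mu,\nu\ge0$, $N\ge3$ and $T>0$. Let $w\in L^1_{loc}([0,\infty))$ be given, which is positive and non-increasing on $[0,\infty)$. Suppose $(v,b,p)\in[L^2(0,T;L^2_{loc,\sigma}(\mathbb{R}^N))]^2\times L^1(0,T;L^1_{loc}(\mathbb{R}^N))$ is a weak solution to $(MHD)_{\mu,\nu}$ on $\mathbb{R}^N\times(0,T)$ with $f,g\in L^1(0,T;L^1_{loc,\sigma}(\mathbb{R}^N))$ such that $$\int_0^T\int_{\mathbb{R}^N}\bigl(|v(x,t)|^2+|b(x,t)|^2+|p(x,t)|\bigr)\left[w(|x|)+\frac{1}{|x|}\int_0^{|x|}w(s)\,ds+\frac{1}{|x|^2}\int_0^{|x|}\int_0^r w(s)\,ds\,dr\right]dx\,dt<\infty$$ and $$\int_{\mathbb{R}^N}p(x,t)\left[w(|x|)+\frac{N-1}{|x|}\int_0^{|x|}w(s)\,ds\right]dx\ge0\quad\text{for } t\in(0,T).$$ Then $b(x,t)=0$ and $v(x,t)=0$ almost everywhere on $\mathbb{R}^N\times(0,T)$.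
   Context: $(MHD)_{\mu,\nu}$ denotes the magnetohydrodynamic equations on $\mathbb{R}^N$, $N\ge3$: $\partial_t v+(v\cdot\nabla)v=(b\cdot\nabla)b-\nabla(p+\frac12|b|^2)+\nu\Delta v+f$, $\ \partial_t b+(v\cdot\nabla)b=(b\cdot\nabla)v+\mu\Delta b+g$, $\ \operatorname{div}v=\operatorname{div}b=0$, where $v=(v_1,\dots,v_N)(x,t)$ is the velocity, $b=(b_1,\dots,b_N)(x,t)$ the magnetic field, $p(x,t)$ the scalar pressure, and $f,g$ are external forces. For $q\in[1,\infty]$, $L^q_{loc,\sigma}(\mathbb{R}^N)$ is the class of vector fields in $[L^q_{loc}(\mathbb{R}^N)]^N$ that are divergence free in the sense of distributions. For $a,c\in\mathbb{R}^N$, $(a\otimes c)_{ij}=a_ic_j$; for $N\times N$ matrices, $A:B=\sum_{i,j=1}^N A_{ij}B_{ij}$; $(\nabla\phi)_{ij}=\partial_i\phi_j$. Weak solution: a triple $(v,b,p)\in[L^2(0,T;L^2_{loc,\sigma}(\mathbb{R}^N))]^2\times L^1(0,T;L^1_{loc}(\mathbb{R}^N))$ is a weak solution of $(MHD)_{\mu,\nu}$ on $\mathbb{R}^N\times(0,T)$ if $$-\int_0^T\!\int_{\mathbb{R}^N} v\cdot\phi\,\xi'\,dx\,dt-\int_0^T\!\int_{\mathbb{R}^N} v\otimes v:\nabla\phi\,\xi\,dx\,dt=-\int_0^T\!\int_{\mathbb{R}^N} b\otimes b:\nabla\phi\,\xi\,dx\,dt+\int_0^T\!\int_{\mathbb{R}^N}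 p\,\operatorname{div}\phi\,\xi\,dx\,dt+\frac12\int_0^T\!\int_{\mathbb{R}^N}|b|^2\operatorname{div}\phi\,\xi\,dx\,dt+\nu\int_0^T\!\int_{\mathbb{R}^N} v\cdot\Delta\phi\,\xi\,dx\,dt+\int_0^T\!\int_{\mathbb{R}^N} f\cdot\phi\,\xi\,dx\,dt$$ and $$-\int_0^T\!\int_{\mathbb{R}^N} b\cdot\phi\,\xi'\,dx\,dt-\int_0^T\!\int_{\mathbb{R}^N} v\otimes b:\nabla\phi\,\xi\,dx\,dt=-\int_0^T\!\int_{\mathbb{R}^N} b\otimes v:\nabla\phi\,\xi\,dx\,dt+\mu\int_0^T\!\int_{\mathbb{R}^N} b\cdot\Delta\phi\,\xi\,dx\,dt+\int_0^T\!\int_{\mathbb{R}^N} g\cdot\phi\,\xi\,dx\,dt$$ for all $\xi=\xi(t)\in C^1_0(0,T)$ and $\phi=\phi(x)\in[C_0^2(\mathbb{R}^N)]^N$ (subscript $0$ denotes compact support). *)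

theory Defs
  imports "HOL-Analysis.Analysis"
begin

subsection \<open>Differential operators and test functions\<close>

definition partial :: "'n \<Rightarrow> (real^'n \<Rightarrow> 'b::real_normed_vector) \<Rightarrow> real^'n \<Rightarrow> 'b" where
  "partial i \<phi> x = frechet_derivative \<phi> (at x) (axis i 1)"

primrec C_k :: "nat \<Rightarrow> (real^'n \<Rightarrow> 'b::real_normed_vector) \<Rightarrow> bool" where
  "C_k 0 \<phi> \<longleftrightarrow> continuous_on UNIV \<phi>"
| "C_k (Suc k) \<phi> \<longleftrightarrow> (\<forall>x. \<phi> differentiable (at x)) \<and> (\<forall>i. C_k k (partial i \<phi>))"

definition supp :: "('a::topological_space \<Rightarrow> 'b::zero) \<Rightarrow> 'a set" where
  "supp \<phi> = closure {x. \<phi> x \<noteq> 0}"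

definition grad :: "(real^'n \<Rightarrow> real) \<Rightarrow> real^'n \<Rightarrow> real^'n" where
  "grad \<psi> x = (\<chi> i. partial i \<psi> x)"

text \<open>Row index = direction of differentiation: the entry at i, j is the i-th partial derivative
  of the j-th component.\<close>

definition grad_vec :: "(real^'n \<Rightarrow> real^'n) \<Rightarrow> real^'n \<Rightarrow> real^'n^'n" where
  "grad_vec \<phi> x = (\<chi> i j. partial i \<phi> x $ j)"

definition divergence :: "(real^'n \<Rightarrow> real^'n) \<Rightarrow> real^'n \<Rightarrow> real" where
  "divergence \<phi> x = (\<Sum>i\<in>UNIV. partial i \<phi> x $ i)"

definition laplacian :: "(real^'n \<Rightarrow> 'b::real_normed_vector) \<Rightarrow> real^'n \<Rightarrow> 'b" where
  "laplacian \<phi> x = (\<Sum>i\<in>UNIV. partial i (partial i \<phi>) x)"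

text \<open>The contraction A : B of two matrices is the inner product of the type
  \<^typ>\<open>real^'n^'n\<close>, i.e. the sum over i, j of the products of entries.\<close>

definition tensor :: "real^'n \<Rightarrow> real^'n \<Rightarrow> real^'n^'n" where
  "tensor a c = (\<chi> i j. a $ i * c $ j)"

subsection \<open>Function spaces\<close>

text \<open>Elements of Lebesgue spaces are represented by Lebesgue measurable functions, and only
  properties that do not depend on the representative are used. The exponent q is finite.\<close>

definition Lq_loc :: "real \<Rightarrow> (real^'n \<Rightarrow> 'b::euclidean_space) \<Rightarrow> bool" where
  "Lq_loc q u \<longleftrightarrow> u \<in> borel_measurable lebesgue \<and>
     (\<forall>K. compact K \<longrightarrow> (\<integral>\<^sup>+x\<in>K. ennreal (norm (u x) powr q) \<partial>lebesgue) < \<infinity>)"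

definition weakly_div_free :: "(real^'n \<Rightarrow> real^'n) \<Rightarrow> bool" where
  "weakly_div_free u \<longleftrightarrow>
     (\<forall>\<psi>. (\<forall>k. C_k k \<psi>) \<and> compact (supp \<psi>) \<longrightarrow> (LINT x|lebesgue. u x \<bullet> grad \<psi> x) = 0)"

definition Lq_loc_sigma :: "real \<Rightarrow> (real^'n \<Rightarrow> real^'n) \<Rightarrow> bool" where
  "Lq_loc_sigma q u \<longleftrightarrow> Lq_loc q u \<and> weakly_div_free u"

text \<open>The space \<open>L\<^sup>q(0,T; L\<^sup>q\<^sub>l\<^sub>o\<^sub>c)\<close>: for every compact K the q-th power
  of the norm in \<open>L\<^sup>q(0,T; L\<^sup>q(K))\<close> is finite. Functions take the space variable first.\<close>

definition Lq_time_Lq_loc :: "real \<Rightarrow> real \<Rightarrow> (real^'n \<Rightarrow> real \<Rightarrow> 'b::euclidean_space) \<Rightarrow> bool" where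
  "Lq_time_Lq_loc q T u \<longleftrightarrow>
     (\<lambda>z. u (fst z) (snd z)) \<in> borel_measurable (lebesgue_on (UNIV \<times> {0<..<T})) \<and>
     (AE t in lebesgue_on {0<..<T}. Lq_loc q (\<lambda>x. u x t)) \<and>
     (\<forall>K. compact K \<longrightarrow>
        (\<integral>\<^sup>+t. (\<integral>\<^sup>+x\<in>K. ennreal (norm (u x t) powr q) \<partial>lebesgue) \<partial>lebesgue_on {0<..<T}) < \<infinity>)"

definition Lq_time_Lq_loc_sigma :: "real \<Rightarrow> real \<Rightarrow> (real^'n \<Rightarrow> real \<Rightarrow> real^'n) \<Rightarrow> bool" where
  "Lq_time_Lq_loc_sigma q T u \<longleftrightarrow> Lq_time_Lq_loc q T u \<and>
     (AE t in lebesgue_on {0<..<T}. Lq_loc_sigma q (\<lambda>x. u x t))"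

definition L1_loc_halfline :: "(real \<Rightarrow> real) \<Rightarrow> bool" where
  "L1_loc_halfline w \<longleftrightarrow> (\<forall>K. compact K \<and> K \<subseteq> {0..} \<longrightarrow> set_integrable lebesgue K w)"

subsection \<open>Weak solutions of the magnetohydrodynamic equations\<close>

text \<open>Test functions on the open interval from 0 to T are extended by 0 to the real line.\<close>

definition MHD_weak_solution ::
  "real \<Rightarrow> real \<Rightarrow> real \<Rightarrow> (real^'n \<Rightarrow> real \<Rightarrow> real^'n) \<Rightarrow> (real^'n \<Rightarrow> real \<Rightarrow> real^'n) \<Rightarrow>
   (real^'n \<Rightarrow> real \<Rightarrow> real^'n) \<Rightarrow> (real^'n \<Rightarrow> real \<Rightarrow> real^'n) \<Rightarrow> (real^'n \<Rightarrow> real \<Rightarrow> real) \<Rightarrow> bool" where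
  "MHD_weak_solution \<mu> \<nu> T f g v b p \<longleftrightarrow>
     Lq_time_Lq_loc_sigma 2 T v \<and> Lq_time_Lq_loc_sigma 2 T b \<and> Lq_time_Lq_loc 1 T p \<and>
     (\<forall>\<xi> \<phi>. \<xi> C1_differentiable_on UNIV \<and> compact (supp \<xi>) \<and> supp \<xi> \<subseteq> {0<..<T} \<and>
            C_k 2 \<phi> \<and> compact (supp \<phi>) \<longrightarrow>
        - (LINT t|lebesgue_on {0<..<T}. LINT x|lebesgue. v x t \<bullet> \<phi> x * deriv \<xi> t)
        - (LINT t|lebesgue_on {0<..<T}. LINT x|lebesgue.
             tensor (v x t) (v x t) \<bullet> grad_vec \<phi> x * \<xi> t)
        = - (LINT t|lebesgue_on {0<..<T}. LINT x|lebesgue.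
               tensor (b x t) (b x t) \<bullet> grad_vec \<phi> x * \<xi> t)
          + (LINT t|lebesgue_on {0<..<T}. LINT x|lebesgue. p x t * divergence \<phi> x * \<xi> t)
          + 1/2 * (LINT t|lebesgue_on {0<..<T}. LINT x|lebesgue.
               (norm (b x t))\<^sup>2 * divergence \<phi> x * \<xi> t)
          + \<nu> * (LINT t|lebesgue_on {0<..<T}. LINT x|lebesgue. v x t \<bullet> laplacian \<phi> x * \<xi> t)
          + (LINT t|lebesgue_on {0<..<T}. LINT x|lebesgue. f x t \<bullet> \<phi> x * \<xi> t)
      \<and>
        - (LINT t|lebesgue_on {0<..<T}. LINT x|lebesgue. b x t \<bullet> \<phi> x * deriv \<xi> t)
        - (LINT t|lebesgue_on {0<..<T}. LINT x|lebesgue.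
             tensor (v x t) (b x t) \<bullet> grad_vec \<phi> x * \<xi> t)
        = - (LINT t|lebesgue_on {0<..<T}. LINT x|lebesgue.
               tensor (b x t) (v x t) \<bullet> grad_vec \<phi> x * \<xi> t)
          + \<mu> * (LINT t|lebesgue_on {0<..<T}. LINT x|lebesgue. b x t \<bullet> laplacian \<phi> x * \<xi> t)
          + (LINT t|lebesgue_on {0<..<T}. LINT x|lebesgue. g x t \<bullet> \<phi> x * \<xi> t))"

end

theory Submission
  imports Defs
begin

text \<open>
  The momentum equation is tested with the gradient of a radial function \<open>\<Psi>\<close>. A gradient is
  orthogonal to every divergence free field, and so is its Laplacian, which is again a gradient;
  hence the time derivative, the viscous term and the force disappear, and the equation becomes
  \<open>\<integral>\<integral> H : \<nabla>\<^sup>2\<Psi> \<xi> dx dt = 0\<close> with the stress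
  \<open>H = v \<otimes> v - b \<otimes> b + (p + |b|\<^sup>2/2) I\<close>.

  Take \<open>\<Psi>(x) = \<Phi>(|x|)\<close> with \<open>\<Phi>'' = w\<close> and \<open>\<Phi>(0) = \<Phi>'(0) = 0\<close>, and put
  \<open>W = \<Phi>'\<close>. The Hessian of \<open>\<Psi>\<close> has the eigenvalue \<open>w(r)\<close> in the radial direction and
  \<open>W(r)/r\<close> in the tangential ones. Since \<open>w\<close> is non-increasing, its mean \<open>W(r)/r\<close> is at least
  \<open>w(r)\<close>. The velocity therefore contributes at least \<open>w |v|\<^sup>2\<close>. For the magnetic field,
  the isotropic part \<open>|b|\<^sup>2/2\<close> times the Laplacian \<open>w + (N-1) W/r\<close> outweighs
  \<open>b \<otimes> b : \<nabla>\<^sup>2\<Psi>\<close> as soon as \<open>N \<ge> 3\<close>, and \<open>w |b|\<^sup>2/2\<close> is left over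
  (\<open>hessian_forms_lower_bounds\<close>). The pressure contributes a nonnegative amount by
  hypothesis. A sum of nonnegative terms vanishes only if each of them does, so \<open>v = b = 0\<close>
  (\<open>fields_vanish\<close>).

  The function \<open>\<Psi>\<close> is neither smooth nor compactly supported, and \<open>w\<close> may jump or blow up at 0.
  It is replaced by \<open>G\<^sub>n(|x|\<^sup>2)\<close>, where \<open>G\<^sub>n\<close> is a polynomial times a smooth cutoff. The
  polynomial comes from the Stone-Weierstrass theorem, applied in the variable \<open>r\<^sup>2\<close> to averages
  of \<open>w\<close>. The error allowed on \<open>[0, n]\<close> is a small multiple of \<open>w(n)\<close>, so that all
  approximations stay below \<open>2 w\<close> there and their Hessians are bounded, uniformly in \<open>n\<close>, by
  exactly the weight of the integrability hypothesis (\<open>radial_test_functions\<close>). A single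
  application of dominated convergence then gives the identity for \<open>\<Psi>\<close>
  (\<open>stress_functional_limit_zero\<close>).
\<close>

section \<open>Smooth functions of one real variable\<close>

primrec C_real :: "nat \<Rightarrow> (real \<Rightarrow> real) \<Rightarrow> bool" where
  "C_real 0 F \<longleftrightarrow> continuous_on UNIV F"
| "C_real (Suc k) F \<longleftrightarrow> (\<exists>F'. (\<forall>s. (F has_real_derivative F' s) (at s)) \<and> C_real k F')"

definition smooth_real :: "(real \<Rightarrow> real) \<Rightarrow> bool" where
  "smooth_real F \<longleftrightarrow> (\<forall>k. C_real k F)"

lemma C_real_Suc_imp: "C_real (Suc k) F \<Longrightarrow> C_real k F"
proof (induction k arbitrary: F)
  case 0
  then show ?case
    by (auto intro!: continuous_at_imp_continuous_on intro: DERIV_isCont)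
next
  case (Suc k)
  then show ?case by (metis C_real.simps(2))
qed

lemma C_real_SucI:
  "(\<And>s. (F has_real_derivative F' s) (at s)) \<Longrightarrow> C_real k F' \<Longrightarrow> C_real (Suc k) F"
  by auto

lemma C_real_const: "C_real k (\<lambda>_. c)"
  by (induction k arbitrary: c) (auto intro!: exI[of _ "\<lambda>_. 0"])

lemma C_real_ident: "C_real k (\<lambda>s. s)"
  by (cases k) (auto intro!: exI[of _ "\<lambda>_. 1"] C_real_const)

lemma C_real_add: "C_real k F \<Longrightarrow> C_real k G \<Longrightarrow> C_real k (\<lambda>s. F s + G s)"
proof (induction k arbitrary: F G)
  case 0
  then show ?case by (auto intro: continuous_intros)
next
  case (Suc k)
  then obtain F' G' where "\<And>s. (F has_real_derivative F' s) (at s)" "C_real k F'"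
     "\<And>s. (G has_real_derivative G' s) (at s)" "C_real k G'" by auto
  then show ?case
    by (intro C_real_SucI[where F'="\<lambda>s. F' s + G' s"] Suc.IH) (auto intro!: derivative_intros)
qed

lemma C_real_mult: "C_real k F \<Longrightarrow> C_real k G \<Longrightarrow> C_real k (\<lambda>s. F s * G s)"
proof (induction k arbitrary: F G)
  case 0
  then show ?case by (auto intro: continuous_intros)
next
  case (Suc k)
  then obtain F' G' where *: "\<And>s. (F has_real_derivative F' s) (at s)" "C_real k F'"
     "\<And>s. (G has_real_derivative G' s) (at s)" "C_real k G'" by auto
  have "C_real k F" "C_real k G" using Suc.prems C_real_Suc_imp by blast+
  with * show ?case
    by (intro C_real_SucI[where F'="\<lambda>s. F' s * G s + F s * G' s"] Suc.IH C_real_add)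
      (auto intro!: derivative_eq_intros)
qed

lemma C_real_affine: "C_real k F \<Longrightarrow> C_real k (\<lambda>s. F (c * s + d))"
proof (induction k arbitrary: F)
  case 0
  then show ?case
    by (auto intro!: continuous_intros continuous_on_compose2[of UNIV F])
next
  case (Suc k)
  then obtain F' where *: "\<And>s. (F has_real_derivative F' s) (at s)" "C_real k F'" by auto
  have "((\<lambda>s. F (c * s + d)) has_real_derivative c * F' (c * s + d)) (at s)" for s
  proof -
    have "((\<lambda>s. c * s + d) has_real_derivative c) (at s)"
      by (auto intro!: derivative_eq_intros)
    from DERIV_chain2[OF *(1) this] show ?thesis by (simp add: mult.commute)
  qed
  with * show ?case
    by (intro C_real_SucI[where F'="\<lambda>s. c * F' (c * s + d)"] C_real_mult[OF C_real_const Suc.IH]) auto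
qed

lemma smooth_real_intros:
  shows smooth_real_const: "smooth_real (\<lambda>_. c)"
    and smooth_real_ident: "smooth_real (\<lambda>s. s)"
    and smooth_real_add: "smooth_real F \<Longrightarrow> smooth_real G \<Longrightarrow> smooth_real (\<lambda>s. F s + G s)"
    and smooth_real_mult: "smooth_real F \<Longrightarrow> smooth_real G \<Longrightarrow> smooth_real (\<lambda>s. F s * G s)"
    and smooth_real_affine: "smooth_real F \<Longrightarrow> smooth_real (\<lambda>s. F (c * s + d))"
  by (simp_all add: smooth_real_def C_real_const C_real_ident C_real_add C_real_mult C_real_affine)

lemma smooth_real_power: "smooth_real (\<lambda>s. s ^ m)"
  by (induction m) (auto intro: smooth_real_const smooth_real_ident smooth_real_mult)

lemma smooth_real_sum: "(\<And>i. i \<in> I \<Longrightarrow> smooth_real (F i)) \<Longrightarrow> smooth_real (\<lambda>s. \<Sum>i\<in>I. F i s)"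
  by (induction I rule: infinite_finite_induct) (auto intro: smooth_real_const smooth_real_add)

lemma smooth_real_derivative:
  assumes "smooth_real F" "\<And>s. (F has_real_derivative F' s) (at s)"
  shows "smooth_real F'"
  unfolding smooth_real_def
proof
  fix k
  have "C_real (Suc k) F" using assms(1) by (auto simp: smooth_real_def)
  then obtain F'' where F'': "\<And>s. (F has_real_derivative F'' s) (at s)" "C_real k F''" by auto
  with assms(2) have "F'' = F'" by (auto intro: DERIV_unique)
  with F'' show "C_real k F'" by simp
qed

lemma smooth_real_obtain_derivative:
  assumes "smooth_real F"
  obtains F' where "\<And>s. (F has_real_derivative F' s) (at s)" "smooth_real F'"
proof -
  have "C_real (Suc 0) F" using assms by (simp only: smooth_real_def)
  then obtain F' where "\<And>s. (F has_real_derivative F' s) (at s)" by auto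
  with smooth_real_derivative[OF assms this] that show ?thesis by blast
qed

lemma smooth_real_continuous: "smooth_real F \<Longrightarrow> continuous_on UNIV F"
  using C_real.simps(1) smooth_real_def by blast

text \<open>For constant \<open>P\<close> this is the classical flat function \<open>exp (- 1/x)\<close>. Polynomials in
  \<open>1/x\<close> are carried along because the class is then closed under differentiation.\<close>

definition flat :: "real poly \<Rightarrow> real \<Rightarrow> real" where
  "flat P x = (if x > 0 then poly P (1 / x) * exp (- (1 / x)) else 0)"

lemma poly_times_exp_minus_tendsto_0: "((\<lambda>y. poly P y * exp (- y)) \<longlongrightarrow> (0::real)) at_top"
proof -
  have "((\<lambda>y. \<Sum>i\<le>degree P. coeff P i * (y ^ i / exp y)) \<longlongrightarrow> (\<Sum>i\<le>degree P. coeff P i * 0)) at_top"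
    by (intro tendsto_sum tendsto_mult tendsto_const tendsto_power_div_exp_0)
  moreover have "poly P y * exp (- y) = (\<Sum>i\<le>degree P. coeff P i * (y ^ i / exp y))" for y
    by (simp add: poly_altdef sum_distrib_right exp_minus divide_inverse mult.assoc)
  ultimately show ?thesis by simp
qed

lemma flat_has_derivative:
  "(flat P has_real_derivative flat (monom 1 2 * (P - pderiv P)) x) (at x)"
proof -
  consider "x > 0" | "x < 0" | "x = 0" by linarith
  then show ?thesis
  proof cases
    case 1
    have "((\<lambda>x. poly P (1 / x) * exp (- (1 / x))) has_real_derivative
        flat (monom 1 2 * (P - pderiv P)) x) (at x)"
      using 1 by (auto intro!: derivative_eq_intros DERIV_chain2[OF poly_DERIV]
          simp: flat_def poly_monom field_simps power2_eq_square)
    then show ?thesis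
      by (rule has_field_derivative_transform_within_open[of _ _ _ "{0<..}"])
        (use 1 in \<open>auto simp: flat_def\<close>)
  next
    case 2
    have "((\<lambda>x. 0) has_real_derivative flat (monom 1 2 * (P - pderiv P)) x) (at x)"
      using 2 by (auto simp: flat_def)
    then show ?thesis
      by (rule has_field_derivative_transform_within_open[of _ _ _ "{..<0}"])
        (use 2 in \<open>auto simp: flat_def\<close>)
  next
    case 3
    have "((\<lambda>h. flat P h / h) \<longlongrightarrow> 0) (at_right 0)"
    proof -
      have "((\<lambda>h::real. poly (monom 1 1 * P) (inverse h) * exp (- inverse h)) \<longlongrightarrow> 0) (at_right 0)"
        by (rule filterlim_compose[OF poly_times_exp_minus_tendsto_0 filterlim_inverse_at_top_right])
      then show ?thesis
        by (rule Lim_transform_eventually)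
          (auto simp: eventually_at_filter flat_def poly_monom field_simps)
    qed
    moreover have "((\<lambda>h. flat P h / h) \<longlongrightarrow> 0) (at_left 0)"
      by (rule Lim_transform_eventually[OF tendsto_const])
        (auto simp: eventually_at_filter flat_def)
    ultimately have "((\<lambda>h. flat P h / h) \<longlongrightarrow> 0) (at 0)"
      by (simp add: filterlim_split_at)
    then have "(flat P has_real_derivative 0) (at 0)"
      by (simp add: DERIV_def flat_def)
    then show ?thesis using 3 by (simp add: flat_def)
  qed
qed

lemma smooth_real_flat: "smooth_real (flat P)"
proof -
  have "C_real k (flat P)" for k
  proof (induction k arbitrary: P)
    case 0
    then show ?case
      using DERIV_isCont[OF flat_has_derivative] by (auto intro!: continuous_at_imp_continuous_on)
  next
    case (Suc k)
    then show ?case using C_real_SucI[OF flat_has_derivative] by blast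
  qed
  then show ?thesis by (simp add: smooth_real_def)
qed

text \<open>The cutoff \<open>exp (1 - 1/(1 - s))\<close> equals 1 only at \<open>s = 0\<close>. This suffices: the cutoffs are
  dilated, so that at a fixed point they are evaluated closer and closer to 0.\<close>

lemma smooth_cutoff:
  obtains \<kappa> :: "real \<Rightarrow> real" where "smooth_real \<kappa>" "\<kappa> 0 = 1" "\<And>s. s \<ge> 1 \<Longrightarrow> \<kappa> s = 0"
proof
  show "smooth_real (\<lambda>s. exp 1 * flat 1 ((-1) * s + 1))"
    by (rule smooth_real_mult[OF smooth_real_const smooth_real_affine[OF smooth_real_flat]])
qed (auto simp: flat_def exp_minus)

section \<open>Functions of class C_k on Euclidean space\<close>

lemma partial_eqI: "(\<phi> has_derivative D) (at x) \<Longrightarrow> partial i \<phi> x = D (axis i 1)"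
  unfolding partial_def using frechet_derivative_at by metis

lemma C_k_Suc_imp: "C_k (Suc k) \<phi> \<Longrightarrow> C_k k \<phi>"
proof (induction k arbitrary: \<phi>)
  case 0
  then show ?case
    by (auto intro!: continuous_at_imp_continuous_on differentiable_imp_continuous_within)
next
  case (Suc k)
  then show ?case by (metis C_k.simps(2))
qed

lemma C_k_SucI:
  assumes "\<And>x. (\<phi> has_derivative D x) (at x)" "\<And>i. C_k k (\<lambda>x. D x (axis i 1))"
  shows "C_k (Suc k) \<phi>"
proof -
  have "partial i \<phi> = (\<lambda>x. D x (axis i 1))" for i
    using partial_eqI[OF assms(1)] by auto
  then show ?thesis using assms by (auto simp: differentiable_def)
qed

lemma C_k_const: "C_k k (\<lambda>_::real^'n. c)"
proof (induction k arbitrary: c)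
  case (Suc k)
  show ?case by (rule C_k_SucI[where D="\<lambda>_ _. 0"]) (auto intro: Suc)
qed auto

lemma C_k_linear:
  assumes "bounded_linear L" shows "C_k k (L :: real^'n \<Rightarrow> _)"
proof (cases k)
  case 0
  then show ?thesis using assms by (auto simp: linear_continuous_on)
next
  case (Suc m)
  show ?thesis unfolding Suc
    by (rule C_k_SucI[where D="\<lambda>_. L"]) (use assms in \<open>auto intro: C_k_const bounded_linear_imp_has_derivative\<close>)
qed

lemma C_k_add: "C_k k \<phi> \<Longrightarrow> C_k k \<psi> \<Longrightarrow> C_k k (\<lambda>x. \<phi> x + \<psi> x)"
proof (induction k arbitrary: \<phi> \<psi>)
  case 0
  then show ?case by (auto intro: continuous_intros)
next
  case (Suc k)
  then have d: "\<And>x. (\<phi> has_derivative frechet_derivative \<phi> (at x)) (at x)"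
    "\<And>x. (\<psi> has_derivative frechet_derivative \<psi> (at x)) (at x)"
    by (auto simp: frechet_derivative_works)
  show ?case
    by (rule C_k_SucI[OF has_derivative_add[OF d]])
      (use Suc in \<open>auto intro!: Suc.IH simp flip: partial_def\<close>)
qed

lemma C_k_scaleR:
  fixes a :: "real^'n \<Rightarrow> real"
  shows "C_k k a \<Longrightarrow> C_k k \<phi> \<Longrightarrow> C_k k (\<lambda>x. a x *\<^sub>R \<phi> x)"
proof (induction k arbitrary: a \<phi>)
  case 0
  then show ?case by (auto intro: continuous_intros)
next
  case (Suc k)
  then have d: "\<And>x. (a has_derivative frechet_derivative a (at x)) (at x)"
    "\<And>x. (\<phi> has_derivative frechet_derivative \<phi> (at x)) (at x)"
    by (auto simp: frechet_derivative_works)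
  have "C_k k a" "C_k k \<phi>" using Suc.prems C_k_Suc_imp by blast+
  then show ?case
    by (intro C_k_SucI[OF has_derivative_scaleR[OF d]])
      (use Suc.prems in \<open>auto intro!: Suc.IH C_k_add simp flip: partial_def\<close>)
qed

lemma has_derivative_radial:
  assumes "\<And>s. (F has_real_derivative F' s) (at s)"
  shows "((\<lambda>x::real^'n. F (x \<bullet> x)) has_derivative (\<lambda>h. 2 * F' (x \<bullet> x) * (x \<bullet> h))) (at x)"
proof -
  have "((\<lambda>x::real^'n. x \<bullet> x) has_derivative (\<lambda>h. 2 * (x \<bullet> h))) (at x)"
    by (auto intro!: derivative_eq_intros simp: inner_commute)
  from has_derivative_compose[OF this assms[unfolded has_field_derivative_def]]
  show ?thesis by (simp add: mult_ac)
qed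

lemma partial_radial:
  assumes "\<And>s. (F has_real_derivative F' s) (at s)"
  shows "partial i (\<lambda>x::real^'n. F (x \<bullet> x)) x = 2 * F' (x \<bullet> x) * x $ i"
  using partial_eqI[OF has_derivative_radial[OF assms]] by (simp add: inner_axis)

text \<open>Composition with \<open>x \<bullet> x\<close>, rather than with the norm, makes radial functions smooth at the
  origin as well.\<close>

lemma C_k_radial:
  assumes "smooth_real F" shows "C_k k (\<lambda>x::real^'n. F (x \<bullet> x))"
  using assms
proof (induction k arbitrary: F)
  case 0
  have "continuous_on UNIV (\<lambda>x::real^'n. F (x \<bullet> x))"
    by (rule continuous_on_compose2[OF smooth_real_continuous[OF 0]]) (auto intro: continuous_intros)
  then show ?case by simp
next
  case (Suc k)
  obtain F' where F': "\<And>s. (F has_real_derivative F' s) (at s)" "smooth_real F'"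
    using smooth_real_obtain_derivative[OF Suc.prems] by blast
  have "C_k k (\<lambda>x::real^'n. F' (x \<bullet> x) *\<^sub>R (2 * (x $ i)))" for i
    by (rule C_k_scaleR[OF Suc.IH[OF F'(2)] C_k_linear])
      (rule bounded_linear_compose[OF bounded_linear_mult_right bounded_linear_vec_nth])
  then have "C_k k (\<lambda>x::real^'n. 2 * F' (x \<bullet> x) * (x \<bullet> axis i 1))" for i
    by (simp add: inner_axis mult_ac)
  then show ?case
    by (rule C_k_SucI[OF has_derivative_radial[OF F'(1)]])
qed

section \<open>Primitives of a non-increasing weight\<close>

locale radial_weight =
  fixes w :: "real \<Rightarrow> real"
  assumes L1_loc: "L1_loc_halfline w"
    and pos: "\<And>r. 0 < r \<Longrightarrow> w r > 0"
    and antimono: "\<And>r s. 0 < r \<Longrightarrow> r \<le> s \<Longrightarrow> w s \<le> w r"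
begin

definition W :: "real \<Rightarrow> real" where "W r = (LINT s:{0..r}|lebesgue. w s)"
definition \<Phi> :: "real \<Rightarrow> real" where "\<Phi> r = (LINT s:{0..r}|lebesgue. W s)"
definition K :: "real \<Rightarrow> real" where "K r = w r + 1 / r * W r + 1 / r\<^sup>2 * \<Phi> r"

lemma set_integrable_w: "set_integrable lebesgue {0..r} w"
  using L1_loc by (auto simp: L1_loc_halfline_def)

lemma w_integrable_on: "0 \<le> a \<Longrightarrow> w integrable_on {a..b}"
  by (rule integrable_on_subinterval[OF set_lebesgue_integral_eq_integral(1)[OF set_integrable_w, of b]]) auto

lemma W_eq_integral: "W r = integral {0..r} w"
  unfolding W_def by (rule set_lebesgue_integral_eq_integral(2)[OF set_integrable_w])

lemma continuous_on_W: "continuous_on {0..R} W"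
  unfolding W_eq_integral[abs_def] by (intro indefinite_integral_continuous_1 w_integrable_on) simp

lemma W_diff: "0 \<le> r \<Longrightarrow> r \<le> r' \<Longrightarrow> W r' - W r = integral {r..r'} w"
  using Henstock_Kurzweil_Integration.integral_combine[of 0 r r' w] w_integrable_on[of 0 r']
  by (simp add: W_eq_integral)

lemma W_diff_upper: "0 < r \<Longrightarrow> r \<le> r' \<Longrightarrow> W r' - W r \<le> (r' - r) * w r"
  using integral_le[of w "{r..r'}" "\<lambda>_. w r"] w_integrable_on[of r r'] antimono[of r]
  by (simp add: W_diff integrable_const_ivl)

text \<open>The left end point may be 0, where the value of \<open>w\<close> is unrelated to its values on the
  positive half-line. It is therefore changed at that point.\<close>

lemma W_diff_lower:
  assumes "0 \<le> r" "r \<le> r'" "0 < r'" shows "(r' - r) * w r' \<le> W r' - W r"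
proof -
  have eq: "integral {r..r'} w = integral {r..r'} (\<lambda>s. if s = 0 then w r' else w s)"
    by (rule integral_spike[of "{0}"]) auto
  have "integral {r..r'} (\<lambda>_. w r') \<le> integral {r..r'} (\<lambda>s. if s = 0 then w r' else w s)"
  proof (rule integral_le)
    show "(\<lambda>s. if s = 0 then w r' else w s) integrable_on {r..r'}"
      by (rule integrable_spike[OF w_integrable_on[OF assms(1)], of "{0}"]) auto
  qed (use assms antimono[of _ r'] in \<open>auto intro: integrable_const_ivl\<close>)
  then show ?thesis using assms by (simp add: W_diff eq)
qed

lemma W_0: "W 0 = 0" by (simp add: W_eq_integral)

lemma w_le_average: "0 < r \<Longrightarrow> w r \<le> 1 / r * W r"
  using W_diff_lower[of 0 r] W_0 by (simp add: field_simps)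

lemma W_pos: "0 < r \<Longrightarrow> W r > 0"
  using W_diff_lower[of 0 r] W_0 pos[of r] mult_pos_pos[of r "w r"] by (auto simp del: mult_pos_pos)

lemma W_nonneg: "0 \<le> r \<Longrightarrow> W r \<ge> 0"
  using W_pos[of r] W_0 by (cases "r = 0") auto

lemma set_integrable_W: "set_integrable lebesgue {0..r} W"
  by (rule absolutely_integrable_continuous_real[OF continuous_on_W])

lemma \<Phi>_nonneg: "0 \<le> r \<Longrightarrow> \<Phi> r \<ge> 0"
  unfolding \<Phi>_def set_lebesgue_integral_def
  by (rule integral_nonneg_AE) (auto simp: indicator_def intro: W_nonneg)

lemma w_le_K: "0 < r \<Longrightarrow> w r \<le> K r"
  and W_le_K: "0 < r \<Longrightarrow> 1 / r * W r \<le> K r"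
  and \<Phi>_le_K: "0 < r \<Longrightarrow> 1 / r\<^sup>2 * \<Phi> r \<le> K r"
  using pos[of r] W_nonneg[of r] \<Phi>_nonneg[of r] by (auto simp: K_def intro!: add_nonneg_nonneg)

lemma countable_discontinuities: "countable {r \<in> {0<..}. \<not> isCont w r}"
proof -
  have "mono_on {0<..} (\<lambda>r. - w r)" by (auto intro!: mono_onI antimono)
  from mono_on_ctble_discont[OF this]
  have "countable {a \<in> {0<..}. \<not> continuous (at a within {0<..}) (\<lambda>r. - w r)}" .
  moreover have "isCont w a" if "a > 0" "continuous (at a within {0<..}) (\<lambda>r. - w r)" for a
    using continuous_minus[OF that(2)] that(1) at_within_open[of a "{0<..}"] by simp
  ultimately show ?thesis by (auto elim!: countable_subset[rotated])
qed

text \<open>The exceptional radii, at which the approximations of \<open>w\<close> need not converge.\<close>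

definition D :: "real set" where "D = insert 0 {r \<in> {0<..}. \<not> isCont w r}"

lemma countable_D: "countable D" using countable_discontinuities by (simp add: D_def)

lemma AE_not_in_D: "AE r in lebesgue. r \<notin> D"
  by (intro AE_completion AE_not_in countable_imp_null_set_lborel countable_D)

text \<open>The mean of \<open>w\<close> over \<open>[r, r + 1/(n+1)]\<close>. It is continuous up to \<open>r = 0\<close> even if \<open>w\<close> is
  unbounded there, and, since it looks to the right, it lies below \<open>w\<close>.\<close>

definition avg :: "nat \<Rightarrow> real \<Rightarrow> real" where
  "avg n r = Suc n * (W (r + 1 / Suc n) - W r)"

lemma avg_le: "0 < r \<Longrightarrow> avg n r \<le> w r"
  using W_diff_upper[of r "r + 1 / Suc n"] by (simp add: avg_def field_simps)

lemma avg_ge: "0 \<le> r \<Longrightarrow> w (r + 1 / Suc n) \<le> avg n r"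
  using W_diff_lower[of r "r + 1 / Suc n"] by (simp add: avg_def field_simps add_pos_nonneg)

lemma continuous_on_avg: "continuous_on {0..R} (avg n)"
proof -
  define h where "h = 1 / real (Suc n)"
  have h: "0 \<le> h" by (simp add: h_def)
  have "continuous_on {0..R} (\<lambda>r. W (r + h))"
    by (rule continuous_on_compose2[OF continuous_on_W[of "R + h"]])
      (use h in \<open>auto intro: continuous_intros\<close>)
  then show ?thesis
    unfolding avg_def[abs_def] h_def[symmetric]
    by (intro continuous_on_mult continuous_on_const continuous_on_diff continuous_on_W)
qed

lemma avg_tendsto:
  assumes "r > 0" "r \<notin> D" shows "(\<lambda>n. avg n r) \<longlonglongrightarrow> w r"
proof (rule tendsto_sandwich)
  have "(\<lambda>n. r + 1 / Suc n) \<longlonglongrightarrow> r + 0"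
    by (intro tendsto_intros LIMSEQ_Suc[OF lim_1_over_n, where ?'a1=real])
  then show "(\<lambda>n. w (r + 1 / Suc n)) \<longlonglongrightarrow> w r"
    using assms isCont_tendsto_compose[of r w] by (auto simp: D_def)
qed (use assms avg_le avg_ge in \<open>auto\<close>)

text \<open>Stone-Weierstrass for \<open>s \<mapsto> a (sqrt s)\<close> on \<open>[0, R\<^sup>2]\<close>.\<close>

lemma even_polynomial_approximation:
  fixes a :: "real \<Rightarrow> real"
  assumes "continuous_on {0..R} a" "\<epsilon> > 0" "R \<ge> 0"
  obtains c :: "nat \<Rightarrow> real" and m :: nat
  where "\<And>r. 0 \<le> r \<Longrightarrow> r \<le> R \<Longrightarrow> \<bar>(\<Sum>i\<le>m. c i * (r\<^sup>2) ^ i) - a r\<bar> < \<epsilon>"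
proof -
  have "continuous_on {0..R\<^sup>2} (\<lambda>s. a (sqrt s))"
    by (intro continuous_on_compose2[OF assms(1)] continuous_intros)
      (use assms(3) in \<open>auto intro: real_le_lsqrt\<close>)
  from Stone_Weierstrass_real_polynomial_function[OF compact_Icc this assms(2)]
  obtain g where g: "real_polynomial_function g"
    "\<And>x. x \<in> {0..R\<^sup>2} \<Longrightarrow> \<bar>a (sqrt x) - g x\<bar> < \<epsilon>" by metis
  from g(1) obtain c m where "g = (\<lambda>x. \<Sum>i\<le>m. c i * x ^ i)"
    by (auto simp: real_polynomial_function_iff_sum)
  moreover have "\<bar>g (r\<^sup>2) - a r\<bar> < \<epsilon>" if "0 \<le> r" "r \<le> R" for r
    using g(2)[of "r\<^sup>2"] that by (simp add: abs_minus_commute power_mono)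
  ultimately show ?thesis by (intro that[where c=c and m=m]) auto
qed


text \<open>Dominated convergence on \<open>[0, r]\<close> with majorant \<open>2 w\<close>; bounds are only needed off the
  null set of exceptional radii.\<close>

lemma set_integral_tendsto:
  fixes a :: "nat \<Rightarrow> real \<Rightarrow> real" and r :: real
  assumes "\<And>n. continuous_on {0..r} (a n)"
    and "\<And>n s. 0 < s \<Longrightarrow> s \<le> r \<Longrightarrow> \<bar>a n s\<bar> \<le> 2 * w s"
    and "\<And>s. 0 < s \<Longrightarrow> s \<le> r \<Longrightarrow> s \<notin> D \<Longrightarrow> (\<lambda>n. a n s) \<longlonglongrightarrow> w s"
  shows "(\<lambda>n. LINT s:{0..r}|lebesgue. a n s) \<longlonglongrightarrow> W r"
  unfolding W_def set_lebesgue_integral_def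
proof (rule integral_dominated_convergence)
  have meas: "set_integrable lebesgue {0..r} (a n)" for n
    by (rule absolutely_integrable_continuous_real[OF assms(1)])
  then show "(\<lambda>s. indicator {0..r} s *\<^sub>R a n s) \<in> borel_measurable lebesgue" for n
    unfolding set_integrable_def by (rule borel_measurable_integrable)
  show "(\<lambda>s. indicator {0..r} s *\<^sub>R w s) \<in> borel_measurable lebesgue"
    using set_integrable_w unfolding set_integrable_def by (rule borel_measurable_integrable)
  show "integrable lebesgue (\<lambda>s. 2 * (indicator {0..r} s *\<^sub>R w s))"
    using set_integrable_w unfolding set_integrable_def by (rule integrable_mult_right)
  show "AE s in lebesgue. (\<lambda>n. indicator {0..r} s *\<^sub>R a n s) \<longlonglongrightarrow> indicator {0..r} s *\<^sub>R w s"
    using AE_not_in_D by eventually_elim (use assms(3) in \<open>auto simp: indicator_def D_def\<close>)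
  show "AE s in lebesgue. norm (indicator {0..r} s *\<^sub>R a n s) \<le> 2 * (indicator {0..r} s *\<^sub>R w s)" for n
    using AE_not_in_D by eventually_elim (use assms(2) in \<open>auto simp: indicator_def D_def\<close>)
qed

lemma abs_set_integral_le:
  fixes a u :: "real \<Rightarrow> real" and r :: real
  assumes "continuous_on {0..r} a" "set_integrable lebesgue {0..r} u"
    and "\<And>s. 0 < s \<Longrightarrow> s \<le> r \<Longrightarrow> \<bar>a s\<bar> \<le> 2 * u s"
  shows "\<bar>LINT s:{0..r}|lebesgue. a s\<bar> \<le> 2 * (LINT s:{0..r}|lebesgue. u s)"
proof -
  have int: "integrable lebesgue (\<lambda>s. indicator {0..r} s *\<^sub>R a s)"
    using absolutely_integrable_continuous_real[OF assms(1)] unfolding set_integrable_def .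
  have "\<bar>LINT s:{0..r}|lebesgue. a s\<bar> \<le> (LINT s|lebesgue. norm (indicator {0..r} s *\<^sub>R a s))"
    unfolding set_lebesgue_integral_def
    using integral_norm_bound[of lebesgue "\<lambda>s. indicator {0..r} s *\<^sub>R a s"] by simp
  also have "\<dots> \<le> (LINT s|lebesgue. 2 * (indicator {0..r} s *\<^sub>R u s))"
  proof (rule integral_mono_AE)
    show "AE s in lebesgue. norm (indicator {0..r} s *\<^sub>R a s) \<le> 2 * (indicator {0..r} s *\<^sub>R u s)"
      using AE_not_in_D by eventually_elim (use assms(3) in \<open>auto simp: indicator_def D_def\<close>)
  qed (use int assms(2) in \<open>auto simp: set_integrable_def\<close>)
  finally show ?thesis by (simp add: set_lebesgue_integral_def)
qed

lemma set_integral_derivative: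
  fixes f f' :: "real \<Rightarrow> real"
  assumes "\<And>s. (f has_real_derivative f' s) (at s)" "continuous_on {0..r} f'" "f 0 = 0" "0 \<le> r"
  shows "(LINT s:{0..r}|lebesgue. f' s) = f r"
proof -
  have "(f' has_integral f r - f 0) {0..r}"
    by (intro fundamental_theorem_of_calculus)
      (use assms in \<open>auto simp: has_real_derivative_iff_has_vector_derivative[symmetric] intro: DERIV_subset\<close>)
  then show ?thesis
    using set_lebesgue_integral_eq_integral(2)[OF absolutely_integrable_continuous_real[OF assms(2)]] assms(3)
    by (simp add: integral_unique)
qed

end

section \<open>Smooth radial test functions adapted to the weight\<close>

context radial_weight
begin

text \<open>If \<open>\<psi>(r) = Q(r\<^sup>2)\<close>, then \<open>\<psi>'(r) = 2 r Q'(r\<^sup>2)\<close> and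
  \<open>\<psi>''(r) = 2 Q'(r\<^sup>2) + 4 r\<^sup>2 Q''(r\<^sup>2)\<close>. The operator \<open>Q \<mapsto> 2 Q' + 4 s Q''\<close> maps polynomials
  vanishing at 0 onto all polynomials, so \<open>\<psi>''\<close> can be made the approximation of \<open>w\<close>, and the
  bounds and limits of \<open>\<psi>'\<close> and \<open>\<psi>\<close> follow by integration.\<close>

lemma polynomial_profiles:
  obtains Q Q1 Q2 :: "nat \<Rightarrow> real \<Rightarrow> real"
  where "\<And>n. smooth_real (Q n)"
    and "\<And>n s. (Q n has_real_derivative Q1 n s) (at s)"
    and "\<And>n s. (Q1 n has_real_derivative Q2 n s) (at s)"
    and "\<And>n r. 0 < r \<Longrightarrow> r \<le> real (Suc n) \<Longrightarrow> \<bar>2 * Q1 n (r\<^sup>2) + 4 * r\<^sup>2 * Q2 n (r\<^sup>2)\<bar> \<le> 2 * w r"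
    and "\<And>n r. 0 < r \<Longrightarrow> r \<le> real (Suc n) \<Longrightarrow> \<bar>2 * r * Q1 n (r\<^sup>2)\<bar> \<le> 2 * W r"
    and "\<And>n r. 0 < r \<Longrightarrow> r \<le> real (Suc n) \<Longrightarrow> \<bar>Q n (r\<^sup>2)\<bar> \<le> 2 * \<Phi> r"
    and "\<And>r. 0 < r \<Longrightarrow> r \<notin> D \<Longrightarrow> (\<lambda>n. 2 * Q1 n (r\<^sup>2) + 4 * r\<^sup>2 * Q2 n (r\<^sup>2)) \<longlonglongrightarrow> w r"
    and "\<And>r. 0 < r \<Longrightarrow> (\<lambda>n. 2 * r * Q1 n (r\<^sup>2)) \<longlonglongrightarrow> W r"
proof -
  have "\<exists>c m. \<forall>r::real. 0 \<le> r \<and> r \<le> real (Suc n) \<longrightarrow> \<bar>(\<Sum>i\<le>m. c i * (r\<^sup>2) ^ i) - avg n r\<bar> < w (Suc n) / Suc n" for n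
    by (rule even_polynomial_approximation[OF continuous_on_avg, of "w (Suc n) / Suc n" "Suc n" n])
      (auto intro!: divide_pos_pos pos)
  then have "\<forall>n. \<exists>cm. \<forall>r::real. 0 \<le> r \<and> r \<le> real (Suc n) \<longrightarrow>
      \<bar>(\<Sum>i\<le>snd cm. fst cm i * (r\<^sup>2) ^ i) - avg n r\<bar> < w (Suc n) / Suc n"
    by (metis fst_conv snd_conv)
  from choice[OF this] obtain cm where cm_ex: "\<forall>n. \<forall>r::real. 0 \<le> r \<and> r \<le> real (Suc n) \<longrightarrow>
      \<bar>(\<Sum>i\<le>snd (cm n). fst (cm n) i * (r\<^sup>2) ^ i) - avg n r\<bar> < w (Suc n) / Suc n" ..
  define c where "c n = fst (cm n)" for n
  define m where "m n = snd (cm n)" for n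
  have cm: "\<And>n r. 0 \<le> r \<Longrightarrow> r \<le> real (Suc n) \<Longrightarrow> \<bar>(\<Sum>i\<le>m n. c n i * (r\<^sup>2) ^ i) - avg n r\<bar> < w (Suc n) / Suc n"
    for n r using cm_ex by (auto simp: c_def m_def)
  \<comment> \<open>the coefficients of \<open>Q'\<close>: a power \<open>s\<^sup>i\<close> is multiplied by \<open>2 (2 i + 1)\<close> under \<open>Q' \<mapsto> 2 Q' + 4 s Q''\<close>\<close>
  define q where "q n s = (\<Sum>i\<le>m n. c n i * s ^ i)" for n and s :: real
  define d where "d n i = c n i / (2 * (2 * real i + 1))" for n i
  define Q where "Q n s = (\<Sum>i\<le>m n. d n i / (real i + 1) * s ^ Suc i)" for n s
  define Q1 where "Q1 n s = (\<Sum>i\<le>m n. d n i * s ^ i)" for n s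
  define Q2 where "Q2 n s = (\<Sum>i\<le>m n. d n i * (real i * s ^ (i - Suc 0)))" for n s
  have Q: "(Q n has_real_derivative Q1 n s) (at s)" for n s
    unfolding Q_def Q1_def
  proof (rule DERIV_sum)
    fix i
    have "((\<lambda>s. d n i / (real i + 1) * s ^ Suc i) has_real_derivative
        d n i / (real i + 1) * (real (Suc i) * s ^ i)) (at s)"
      by (auto intro!: derivative_eq_intros simp del: power_Suc)
    also have "d n i / (real i + 1) * (real (Suc i) * s ^ i) = d n i * s ^ i"
      by (simp add: add.commute)
    finally show "((\<lambda>s. d n i / (real i + 1) * s ^ Suc i) has_real_derivative d n i * s ^ i) (at s)" .
  qed
  have Q1: "(Q1 n has_real_derivative Q2 n s) (at s)" for n s
    unfolding Q2_def Q1_def by (auto intro!: derivative_eq_intros sum.cong simp: field_simps)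
  have q: "2 * Q1 n s + 4 * s * Q2 n s = q n s" for n s
  proof -
    have "2 * (d n i * s ^ i) + 4 * s * (d n i * (real i * s ^ (i - Suc 0))) = c n i * s ^ i" for i
    proof -
      have "s * (real i * s ^ (i - Suc 0)) = real i * s ^ i" by (cases i) auto
      then have "4 * s * (d n i * (real i * s ^ (i - Suc 0))) = 4 * d n i * (real i * s ^ i)"
        by (metis mult.assoc mult.left_commute)
      then have "2 * (d n i * s ^ i) + 4 * s * (d n i * (real i * s ^ (i - Suc 0)))
          = d n i * (2 * (2 * real i + 1)) * s ^ i"
        by (simp add: algebra_simps)
      moreover have "0 < 2 * (2 * real i + 1)" by (simp add: add_nonneg_pos)
      then have "d n i * (2 * (2 * real i + 1)) = c n i"
        using nonzero_eq_divide_eq[of "2 * (2 * real i + 1)" "d n i" "c n i"] by (auto simp: d_def)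
      ultimately show ?thesis by simp
    qed
    then show ?thesis
      unfolding Q1_def Q2_def q_def by (simp add: sum_distrib_left flip: sum.distrib)
  qed
  have smooth: "smooth_real (Q n)" for n
    unfolding Q_def by (intro smooth_real_sum smooth_real_mult smooth_real_const smooth_real_power)
  have cont_q: "continuous_on A (\<lambda>s. q n (s\<^sup>2))" for A n
    unfolding q_def by (intro continuous_intros)
  have cont_Q1: "continuous_on A (\<lambda>s. 2 * s * Q1 n (s\<^sup>2))" for A n
    unfolding Q1_def by (intro continuous_intros)
  have sq: "((\<lambda>s. s\<^sup>2) has_real_derivative 2 * s) (at s)" for s :: real
    by (auto intro!: derivative_eq_intros)
  have D1: "((\<lambda>s. 2 * s * Q1 n (s\<^sup>2)) has_real_derivative q n (s\<^sup>2)) (at s)" for n s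
    by (rule DERIV_cong[OF DERIV_mult[OF DERIV_cmult_Id[of 2] DERIV_chain2[OF Q1 sq]]])
      (simp add: q[symmetric] power2_eq_square)
  have D0: "((\<lambda>s. Q n (s\<^sup>2)) has_real_derivative 2 * s * Q1 n (s\<^sup>2)) (at s)" for n s
    using DERIV_chain2[OF Q sq] by (simp add: mult.commute)
  have I1: "(LINT s:{0..r}|lebesgue. q n (s\<^sup>2)) = 2 * r * Q1 n (r\<^sup>2)" if "0 \<le> r" for n r
    by (rule set_integral_derivative[OF D1 cont_q]) (use that in auto)
  have I0: "(LINT s:{0..r}|lebesgue. 2 * s * Q1 n (s\<^sup>2)) = Q n (r\<^sup>2)" if "0 \<le> r" for n r
    by (rule set_integral_derivative[OF D0 cont_Q1]) (use that in \<open>auto simp: Q_def\<close>)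
  have q_le: "\<bar>q n (r\<^sup>2)\<bar> \<le> 2 * w r" if r: "0 < r" "r \<le> real (Suc n)" for n r
  proof -
    have "w (Suc n) / Suc n \<le> w (Suc n) / 1" using pos[of "Suc n"]
      by (intro divide_left_mono) auto
    moreover have "w (Suc n) \<le> w r" using antimono r by auto
    moreover have "0 < avg n r"
    proof (rule order.strict_trans2[OF pos avg_ge])
      show "0 < r + 1 / real (Suc n)" using r(1) by (simp add: add_pos_pos)
    qed (use r(1) in simp)
    ultimately show ?thesis using cm[of r n] avg_le[of r n] r unfolding q_def by simp
  qed
  have Q1_le: "\<bar>2 * r * Q1 n (r\<^sup>2)\<bar> \<le> 2 * W r" if r: "0 < r" "r \<le> real (Suc n)" for n r
    using abs_set_integral_le[OF cont_q set_integrable_w, of r n] I1[of r n] r q_le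
    by (auto simp: W_def)
  have Q_le: "\<bar>Q n (r\<^sup>2)\<bar> \<le> 2 * \<Phi> r" if r: "0 < r" "r \<le> real (Suc n)" for n r
    using abs_set_integral_le[OF cont_Q1 set_integrable_W, of r n] I0[of r n] r Q1_le
    by (auto simp: \<Phi>_def)
  have q_lim: "(\<lambda>n. q n (r\<^sup>2)) \<longlonglongrightarrow> w r" if r: "0 < r" "r \<notin> D" for r
  proof -
    have "(\<lambda>n. q n (r\<^sup>2) - avg n r) \<longlonglongrightarrow> 0"
    proof (rule Lim_null_comparison)
      have "\<bar>q n (r\<^sup>2) - avg n r\<bar> \<le> w 1 / Suc n" if "n \<ge> nat \<lceil>r\<rceil>" for n
      proof -
        have "r \<le> real (Suc n)" using that by linarith
        moreover have "w (Suc n) / Suc n \<le> w 1 / Suc n"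
          by (intro divide_right_mono antimono) auto
        ultimately show ?thesis using cm[of r n] r(1) unfolding q_def by linarith
      qed
      then show "\<forall>\<^sub>F n in sequentially. norm (q n (r\<^sup>2) - avg n r) \<le> w 1 / Suc n"
        by (intro eventually_mono[OF eventually_ge_at_top[of "nat \<lceil>r\<rceil>"]]) simp
      show "(\<lambda>n. w 1 / Suc n) \<longlonglongrightarrow> 0"
        by (rule LIMSEQ_Suc[OF lim_const_over_n])
    qed
    from tendsto_add[OF this avg_tendsto[OF r]] show ?thesis by simp
  qed
  have Q1_lim: "(\<lambda>n. 2 * r * Q1 n (r\<^sup>2)) \<longlonglongrightarrow> W r" if r: "0 < r" for r
  proof -
    \<comment> \<open>the bound by \<open>2 w\<close> holds on \<open>[0, r]\<close> only for indices beyond \<open>r\<close>\<close>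
    define k where "k = nat \<lceil>r\<rceil>"
    have "(\<lambda>n. LINT s:{0..r}|lebesgue. q (n + k) (s\<^sup>2)) \<longlonglongrightarrow> W r"
    proof (rule set_integral_tendsto[OF cont_q])
      fix n s assume "0 < s" "s \<le> r"
      then show "\<bar>q (n + k) (s\<^sup>2)\<bar> \<le> 2 * w s" by (intro q_le) (auto simp: k_def, linarith)
    qed (rule LIMSEQ_ignore_initial_segment[OF q_lim])
    then show ?thesis using r by (simp add: I1 LIMSEQ_offset[of _ k])
  qed
  show ?thesis
    by (rule that[of Q Q1 Q2]) (use smooth Q Q1 q_le Q1_le Q_le q_lim Q1_lim in \<open>auto simp: q\<close>)
qed

text \<open>The bounds are uniform because the cutoff at scale \<open>n\<close> satisfies
  \<open>r\<^sup>2 |\<kappa>'| + r\<^sup>4 |\<kappa>''| \<le> const\<close> in terms of the variable \<open>r\<^sup>2\<close>: each derivative falling on the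
  cutoff instead of \<open>Q\<close> costs a factor \<open>1 / r\<^sup>2\<close>, which is why \<open>K\<close> contains \<open>W / r\<close> and
  \<open>\<Phi> / r\<^sup>2\<close> besides \<open>w\<close>.
  \<open>2 G1\<close> and \<open>4 r\<^sup>2 G2\<close> are the tangential eigenvalue of the Hessian of \<open>G(|x|\<^sup>2)\<close> and the
  difference between its radial and its tangential eigenvalue.\<close>

lemma radial_test_functions:
  obtains C :: real and G G1 G2 :: "nat \<Rightarrow> real \<Rightarrow> real"
  where "\<And>n. smooth_real (G n)"
    and "\<And>n s. (G n has_real_derivative G1 n s) (at s)"
    and "\<And>n s. (G1 n has_real_derivative G2 n s) (at s)"
    and "\<And>n s. s \<ge> (real (Suc n))\<^sup>2 \<Longrightarrow> G n s = 0"
    and "\<And>n r. 0 < r \<Longrightarrow> \<bar>2 * G1 n (r\<^sup>2)\<bar> \<le> C * K r"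
    and "\<And>n r. 0 < r \<Longrightarrow> \<bar>4 * r\<^sup>2 * G2 n (r\<^sup>2)\<bar> \<le> C * K r"
    and "\<And>r. 0 < r \<Longrightarrow> (\<lambda>n. 2 * G1 n (r\<^sup>2)) \<longlonglongrightarrow> 1 / r * W r"
    and "\<And>r. 0 < r \<Longrightarrow> r \<notin> D \<Longrightarrow> (\<lambda>n. 4 * r\<^sup>2 * G2 n (r\<^sup>2)) \<longlonglongrightarrow> w r - 1 / r * W r"
proof -
  obtain \<kappa> :: "real \<Rightarrow> real" where \<kappa>: "smooth_real \<kappa>" "\<kappa> 0 = 1" "\<And>s. s \<ge> 1 \<Longrightarrow> \<kappa> s = 0"
    using smooth_cutoff by blast
  obtain \<kappa>1 where \<kappa>1: "\<And>s. (\<kappa> has_real_derivative \<kappa>1 s) (at s)" "smooth_real \<kappa>1"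
    using smooth_real_obtain_derivative[OF \<kappa>(1)] by blast
  obtain \<kappa>2 where \<kappa>2: "\<And>s. (\<kappa>1 has_real_derivative \<kappa>2 s) (at s)" "smooth_real \<kappa>2"
    using smooth_real_obtain_derivative[OF \<kappa>1(2)] by blast
  have bdd: "\<exists>M. \<forall>s\<in>{0..1}. \<bar>F s\<bar> \<le> M" if "smooth_real F" for F
    using compact_imp_bounded[OF compact_continuous_image[OF continuous_on_subset[OF smooth_real_continuous[OF that]]], of "{0..1}"]
    by (auto simp: bounded_iff)
  obtain M0 M1 M2 where M012: "\<forall>s\<in>{0..1}. \<bar>\<kappa> s\<bar> \<le> M0" "\<forall>s\<in>{0..1}. \<bar>\<kappa>1 s\<bar> \<le> M1" "\<forall>s\<in>{0..1}. \<bar>\<kappa>2 s\<bar> \<le> M2"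
    using bdd[OF \<kappa>(1)] bdd[OF \<kappa>1(2)] bdd[OF \<kappa>2(2)] by blast
  define M where "M = max M0 (max M1 M2)"
  have M: "\<bar>\<kappa> s\<bar> \<le> M" "\<bar>\<kappa>1 s\<bar> \<le> M" "\<bar>\<kappa>2 s\<bar> \<le> M" if "0 \<le> s" "s \<le> 1" for s
    using M012 that by (auto simp: M_def le_max_iff_disj)
  have "M \<ge> 0" using M(1)[of 0] by auto
  obtain Q Q1 Q2 where Q: "\<And>n. smooth_real (Q n)"
    "\<And>n s. (Q n has_real_derivative Q1 n s) (at s)"
    "\<And>n s. (Q1 n has_real_derivative Q2 n s) (at s)"
    "\<And>n r. 0 < r \<Longrightarrow> r \<le> real (Suc n) \<Longrightarrow> \<bar>2 * Q1 n (r\<^sup>2) + 4 * r\<^sup>2 * Q2 n (r\<^sup>2)\<bar> \<le> 2 * w r"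
    "\<And>n r. 0 < r \<Longrightarrow> r \<le> real (Suc n) \<Longrightarrow> \<bar>2 * r * Q1 n (r\<^sup>2)\<bar> \<le> 2 * W r"
    "\<And>n r. 0 < r \<Longrightarrow> r \<le> real (Suc n) \<Longrightarrow> \<bar>Q n (r\<^sup>2)\<bar> \<le> 2 * \<Phi> r"
    "\<And>r. 0 < r \<Longrightarrow> r \<notin> D \<Longrightarrow> (\<lambda>n. 2 * Q1 n (r\<^sup>2) + 4 * r\<^sup>2 * Q2 n (r\<^sup>2)) \<longlonglongrightarrow> w r"
    "\<And>r. 0 < r \<Longrightarrow> (\<lambda>n. 2 * r * Q1 n (r\<^sup>2)) \<longlonglongrightarrow> W r"
    using polynomial_profiles by blast
  define c where "c n = inverse ((real (Suc n))\<^sup>2)" for n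
  have c: "c n > 0" for n by (simp add: c_def)
  define G where "G n s = \<kappa> (c n * s) * Q n s" for n s
  define G1 where "G1 n s = c n * \<kappa>1 (c n * s) * Q n s + \<kappa> (c n * s) * Q1 n s" for n s
  define G2 where "G2 n s = (c n)\<^sup>2 * \<kappa>2 (c n * s) * Q n s + 2 * c n * \<kappa>1 (c n * s) * Q1 n s
    + \<kappa> (c n * s) * Q2 n s" for n s
  have lin: "((\<lambda>s. c n * s) has_real_derivative c n) (at s)" for n s
    by (auto intro!: derivative_eq_intros)
  note d\<kappa> = DERIV_chain2[OF \<kappa>1(1) lin] DERIV_chain2[OF \<kappa>2(1) lin]
  have smooth: "smooth_real (G n)" for n
    unfolding G_def using smooth_real_affine[OF \<kappa>(1), of "c n" 0] Q(1)[of n]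
    by (intro smooth_real_mult) auto
  have G: "(G n has_real_derivative G1 n s) (at s)" for n s
    unfolding G_def G1_def
    by (auto intro!: derivative_eq_intros d\<kappa> Q(2))
  have G1: "(G1 n has_real_derivative G2 n s) (at s)" for n s
    unfolding G1_def
    by (rule DERIV_cong[OF DERIV_add[OF DERIV_mult[OF DERIV_cmult[OF d\<kappa>(2)] Q(2)]
          DERIV_mult[OF d\<kappa>(1) Q(3)]]])
      (simp add: G2_def algebra_simps power2_eq_square)
  have G_0: "G n s = 0" if "s \<ge> (real (Suc n))\<^sup>2" for n s
  proof -
    have "1 \<le> c n * s" using that by (simp add: c_def field_simps)
    then show ?thesis by (simp add: G_def \<kappa>(3))
  qed
  have G1_0: "G1 n s = 0" if "s > (real (Suc n))\<^sup>2" for n s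
    by (rule DERIV_unique[OF G has_field_derivative_transform_within_open[of "\<lambda>_. 0" 0 _ "{(real (Suc n))\<^sup>2<..}"]])
      (use that G_0 in \<open>auto intro: order.strict_implies_order\<close>)
  have G2_0: "G2 n s = 0" if "s > (real (Suc n))\<^sup>2" for n s
    by (rule DERIV_unique[OF G1 has_field_derivative_transform_within_open[of "\<lambda>_. 0" 0 _ "{(real (Suc n))\<^sup>2<..}"]])
      (use that G1_0 in \<open>auto\<close>)
  have u: "c n * r\<^sup>2 \<le> 1" if "0 < r" "r \<le> real (Suc n)" for r n
    using power_mono[OF that(2), of 2] that(1) by (simp add: c_def field_simps)
  have K0: "K r \<ge> 0" if "r > 0" for r using w_le_K[OF that] pos[OF that] by simp
  have bound: "\<bar>2 * G1 n (r\<^sup>2)\<bar> \<le> 20 * M * K r \<and> \<bar>4 * r\<^sup>2 * G2 n (r\<^sup>2)\<bar> \<le> 20 * M * K r"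
    if r: "r > 0" for n r
  proof (cases "r \<le> real (Suc n)")
    case True
    \<comment> \<open>in the scale invariant variable \<open>u = r\<^sup>2 / (n+1)\<^sup>2\<close> all quantities are products of bounded factors and \<open>K\<close>\<close>
    define u where "u = c n * r\<^sup>2"
    have u: "0 \<le> u" "u \<le> 1" using u[OF r True] c[of n] by (auto simp: u_def)
    then have u2: "u\<^sup>2 \<le> 1" by (simp add: power_le_one)
    define A where "A = Q n (r\<^sup>2) / r\<^sup>2"
    define B where "B = 2 * Q1 n (r\<^sup>2)"
    define E where "E = B + 4 * r\<^sup>2 * Q2 n (r\<^sup>2)"
    have A: "\<bar>A\<bar> \<le> 2 * K r" using Q(6)[OF r True] \<Phi>_le_K[OF r] r by (simp add: A_def field_simps)
    have "r * \<bar>Q1 n (r\<^sup>2)\<bar> \<le> W r" using Q(5)[OF r True] r by (simp add: abs_mult)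
    also have "W r \<le> r * K r" using W_le_K[OF r] r by (simp add: field_simps)
    finally have B: "\<bar>B\<bar> \<le> 2 * K r" using r by (simp add: B_def)
    have E: "\<bar>E\<bar> \<le> 2 * K r" using Q(4)[OF r True] w_le_K[OF r] by (simp add: E_def B_def)
    have p: "\<bar>x * y\<bar> \<le> M * (2 * K r)" if "\<bar>x\<bar> \<le> M" "\<bar>y\<bar> \<le> 2 * K r" for x y
      unfolding abs_mult using that \<open>M \<ge> 0\<close> by (intro mult_mono) auto
    have p': "\<bar>z * (x * y)\<bar> \<le> M * (2 * K r)" if "\<bar>x\<bar> \<le> M" "\<bar>y\<bar> \<le> 2 * K r" "0 \<le> z" "z \<le> 1" for x y z
      using p[OF that(1,2)] mult_mono[OF that(4) p[OF that(1,2)]] that(3) by (simp add: abs_mult)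
    have "2 * G1 n (r\<^sup>2) = 2 * (u * (\<kappa>1 u * A)) + \<kappa> u * B"
      using r by (simp add: G1_def u_def A_def B_def field_simps)
    moreover have "4 * r\<^sup>2 * G2 n (r\<^sup>2) = 4 * (u\<^sup>2 * (\<kappa>2 u * A)) + 4 * (u * (\<kappa>1 u * B)) + \<kappa> u * E - \<kappa> u * B"
      using r by (simp add: G2_def u_def A_def B_def E_def field_simps power2_eq_square)
    ultimately show ?thesis
      using p'[OF M(2)[OF u] A u] p[OF M(1)[OF u] B] p'[OF M(3)[OF u] A zero_le_power2 u2]
        p'[OF M(2)[OF u] B u] p[OF M(1)[OF u] E] mult_nonneg_nonneg[OF \<open>M \<ge> 0\<close> K0[OF r]]
      by (intro conjI) linarith+
  next
    case False
    then have "r\<^sup>2 > (real (Suc n))\<^sup>2" by (intro power_strict_mono) auto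
    then show ?thesis using G1_0[of n "r\<^sup>2"] G2_0[of n "r\<^sup>2"] \<open>M \<ge> 0\<close> K0[OF r] by simp
  qed
  have c_lim: "c \<longlonglongrightarrow> 0"
  proof -
    have "(\<lambda>n. (inverse (real (Suc n)))\<^sup>2) \<longlonglongrightarrow> 0\<^sup>2"
      by (intro tendsto_power LIMSEQ_inverse_real_of_nat)
    then show ?thesis by (simp add: c_def[abs_def] power_inverse)
  qed
  have \<kappa>_lim: "(\<lambda>n. F (c n * s)) \<longlonglongrightarrow> F 0" if "smooth_real F" for F :: "real \<Rightarrow> real" and s
  proof -
    have "isCont F 0" using smooth_real_continuous[OF that] by (simp add: continuous_on_eq_continuous_at)
    moreover have "(\<lambda>n. c n * s) \<longlonglongrightarrow> 0" using tendsto_mult_left_zero[OF c_lim] .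
    ultimately show ?thesis by (rule isCont_tendsto_compose)
  qed
  have Q_small: "(\<lambda>n. c n * Q n (r\<^sup>2)) \<longlonglongrightarrow> 0" if r: "r > 0" for r
  proof (rule Lim_null_comparison)
    have "\<bar>c n * Q n (r\<^sup>2)\<bar> \<le> c n * (2 * \<Phi> r)" if "n \<ge> nat \<lceil>r\<rceil>" for n
    proof -
      have "r \<le> real (Suc n)" using that by linarith
      from Q(6)[OF r this] c[of n] show ?thesis by (simp add: abs_mult)
    qed
    then show "\<forall>\<^sub>F n in sequentially. norm (c n * Q n (r\<^sup>2)) \<le> c n * (2 * \<Phi> r)"
      by (intro eventually_mono[OF eventually_ge_at_top[of "nat \<lceil>r\<rceil>"]]) simp
    show "(\<lambda>n. c n * (2 * \<Phi> r)) \<longlonglongrightarrow> 0" using tendsto_mult_left_zero[OF c_lim] .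
  qed
  have Q1_lim: "(\<lambda>n. 2 * Q1 n (r\<^sup>2)) \<longlonglongrightarrow> 1 / r * W r" if r: "r > 0" for r
    using tendsto_mult_left[OF Q(8)[OF r], of "1 / r"] r by simp
  have lim1: "(\<lambda>n. 2 * G1 n (r\<^sup>2)) \<longlonglongrightarrow> 1 / r * W r" if r: "r > 0" for r
  proof -
    have "(\<lambda>n. 2 * (\<kappa>1 (c n * r\<^sup>2) * (c n * Q n (r\<^sup>2))) + \<kappa> (c n * r\<^sup>2) * (2 * Q1 n (r\<^sup>2)))
        \<longlonglongrightarrow> 2 * (\<kappa>1 0 * 0) + \<kappa> 0 * (1 / r * W r)"
      by (intro tendsto_add tendsto_mult tendsto_const \<kappa>_lim \<kappa>(1) \<kappa>1(2) Q_small Q1_lim r)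
    then show ?thesis by (simp add: G1_def \<kappa>(2) algebra_simps)
  qed
  have lim2: "(\<lambda>n. 4 * r\<^sup>2 * G2 n (r\<^sup>2)) \<longlonglongrightarrow> w r - 1 / r * W r" if r: "r > 0" "r \<notin> D" for r
  proof -
    have "(\<lambda>n. 4 * r\<^sup>2 * (c n * \<kappa>2 (c n * r\<^sup>2) * (c n * Q n (r\<^sup>2)))
          + 4 * r\<^sup>2 * (c n * \<kappa>1 (c n * r\<^sup>2) * (2 * Q1 n (r\<^sup>2)))
          + \<kappa> (c n * r\<^sup>2) * ((2 * Q1 n (r\<^sup>2) + 4 * r\<^sup>2 * Q2 n (r\<^sup>2)) - 2 * Q1 n (r\<^sup>2)))
        \<longlonglongrightarrow> 4 * r\<^sup>2 * (0 * \<kappa>2 0 * 0) + 4 * r\<^sup>2 * (0 * \<kappa>1 0 * (1 / r * W r))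
          + \<kappa> 0 * (w r - 1 / r * W r)"
      by (intro tendsto_add tendsto_mult tendsto_diff tendsto_const \<kappa>_lim \<kappa>(1) \<kappa>1(2) \<kappa>2(2)
          Q_small Q1_lim r c_lim Q(7))
    then show ?thesis by (simp add: G2_def \<kappa>(2) algebra_simps power2_eq_square)
  qed
  show ?thesis
    by (rule that[of G G1 G2 "20 * M"]) (use smooth G G1 G_0 bound lim1 lim2 in auto)
qed

end

section \<open>The momentum equation tested with radial gradients\<close>

lemma compact_supp_radial:
  fixes \<psi> :: "real^'n \<Rightarrow> 'b::zero"
  assumes "\<And>x. x \<bullet> x \<ge> R \<Longrightarrow> \<psi> x = 0"
  shows "compact (supp \<psi>)"
proof -
  have "{x. \<psi> x \<noteq> 0} \<subseteq> cball 0 (sqrt R)"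
    using assms by (force simp: norm_eq_sqrt_inner not_le intro!: real_sqrt_le_mono)
  then have "bounded {x. \<psi> x \<noteq> 0}" using bounded_cball bounded_subset by blast
  then show ?thesis by (simp add: supp_def compact_closure)
qed

lemma grad_radial:
  assumes "\<And>s. (F has_real_derivative F' s) (at s)"
  shows "grad (\<lambda>x::real^'n. F (x \<bullet> x)) x = (2 * F' (x \<bullet> x)) *\<^sub>R x"
  by (simp add: grad_def partial_radial[OF assms] vec_eq_iff)

text \<open>The field \<open>2 F'(x \<bullet> x) x\<close> is the gradient of \<open>F(x \<bullet> x)\<close>.\<close>

lemma weakly_div_free_radial:
  fixes u :: "real^'n \<Rightarrow> real^'n"
  assumes "weakly_div_free u" "smooth_real F" "\<And>s. s \<ge> R \<Longrightarrow> F s = 0"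
    and "\<And>s. (F has_real_derivative F' s) (at s)"
  shows "(LINT x|lebesgue. u x \<bullet> ((2 * F' (x \<bullet> x)) *\<^sub>R x)) = 0"
proof -
  have "(\<forall>k. C_k k (\<lambda>x::real^'n. F (x \<bullet> x))) \<and> compact (supp (\<lambda>x::real^'n. F (x \<bullet> x)))"
    using C_k_radial[OF assms(2)] compact_supp_radial[of R "\<lambda>x::real^'n. F (x \<bullet> x)"] assms(3) by blast
  with assms(1) have "(LINT x|lebesgue. u x \<bullet> grad (\<lambda>x. F (x \<bullet> x)) x) = 0"
    unfolding weakly_div_free_def by blast
  then show ?thesis by (simp add: grad_radial[OF assms(4)])
qed

lemma sum_axis_scaleR: "(\<Sum>i\<in>UNIV. (c * x $ i) *\<^sub>R axis i 1) = c *\<^sub>R (x :: real^'n)"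
  by (simp add: vec_eq_iff axis_def if_distrib cong: if_cong)

lemma sum_components: "(\<Sum>i\<in>UNIV. x $ i * y $ i) = (x :: real^'n) \<bullet> y"
  by (simp add: inner_vec_def)

context
  fixes G1 G2 :: "real \<Rightarrow> real" and \<phi> :: "real^'n \<Rightarrow> real^'n"
  assumes G1: "\<And>s. (G1 has_real_derivative G2 s) (at s)"
  defines "\<phi> \<equiv> \<lambda>x. (2 * G1 (x \<bullet> x)) *\<^sub>R x"
begin

lemma partial_radial_field:
  "partial i \<phi> x = (4 * G2 (x \<bullet> x) * x $ i) *\<^sub>R x + (2 * G1 (x \<bullet> x)) *\<^sub>R axis i 1"
proof -
  have "(\<phi> has_derivative (\<lambda>h. (2 * G1 (x \<bullet> x)) *\<^sub>R h + (2 * (2 * G2 (x \<bullet> x) * (x \<bullet> h))) *\<^sub>R x)) (at x)"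
    unfolding \<phi>_def
    by (intro has_derivative_scaleR has_derivative_ident has_derivative_mult_right has_derivative_radial G1)
  from partial_eqI[OF this] show ?thesis by (simp add: inner_axis algebra_simps)
qed

lemma tensor_inner_grad_radial_field:
  "tensor a c \<bullet> grad_vec \<phi> x = 2 * G1 (x \<bullet> x) * (a \<bullet> c) + 4 * G2 (x \<bullet> x) * ((a \<bullet> x) * (c \<bullet> x))"
proof -
  have "tensor a c \<bullet> grad_vec \<phi> x = (\<Sum>i\<in>UNIV. \<Sum>j\<in>UNIV. a $ i * c $ j *
      (4 * G2 (x \<bullet> x) * x $ i * x $ j + 2 * G1 (x \<bullet> x) * (if j = i then 1 else 0)))"
    by (simp add: inner_vec_def tensor_def grad_vec_def partial_radial_field axis_def if_distrib cong: if_cong)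
  also have "\<dots> = (\<Sum>i\<in>UNIV. \<Sum>j\<in>UNIV. 4 * G2 (x \<bullet> x) * ((a $ i * x $ i) * (c $ j * x $ j)))
      + (\<Sum>i\<in>UNIV. \<Sum>j\<in>UNIV. if j = i then 2 * G1 (x \<bullet> x) * (a $ i * c $ i) else 0)"
    unfolding sum.distrib[symmetric] by (intro sum.cong refl) (auto simp: algebra_simps)
  also have "(\<Sum>i\<in>UNIV. \<Sum>j\<in>UNIV. 4 * G2 (x \<bullet> x) * ((a $ i * x $ i) * (c $ j * x $ j)))
      = 4 * G2 (x \<bullet> x) * ((a \<bullet> x) * (c \<bullet> x))"
    by (simp only: sum_distrib_left[symmetric] sum_distrib_right[symmetric] sum_components)
  also have "(\<Sum>i\<in>UNIV. \<Sum>j\<in>UNIV. if j = i then 2 * G1 (x \<bullet> x) * (a $ i * c $ i) else 0)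
      = 2 * G1 (x \<bullet> x) * (a \<bullet> c)"
    by (simp add: sum_distrib_left[symmetric] sum_components)
  finally show ?thesis by simp
qed

lemma divergence_radial_field:
  "divergence \<phi> x = 2 * real CARD('n) * G1 (x \<bullet> x) + 4 * ((x \<bullet> x) * G2 (x \<bullet> x))"
proof -
  have "divergence \<phi> x = (\<Sum>i\<in>UNIV. 4 * G2 (x \<bullet> x) * (x $ i * x $ i) + 2 * G1 (x \<bullet> x))"
    by (simp add: divergence_def partial_radial_field mult.assoc)
  also have "\<dots> = 4 * G2 (x \<bullet> x) * (x \<bullet> x) + real CARD('n) * (2 * G1 (x \<bullet> x))"
    by (simp add: sum.distrib sum_distrib_left[symmetric] sum_components)
  finally show ?thesis by simp
qed

text \<open>The right-hand side is the gradient of \<open>L(x \<bullet> x)\<close> with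
  \<open>L(s) = 2 N G1(s) + 4 s G2(s)\<close>, the divergence of the field: the Laplacian of a gradient is a
  gradient.\<close>

lemma laplacian_radial_field:
  assumes G2: "\<And>s. (G2 has_real_derivative G3 s) (at s)"
  shows "laplacian \<phi> x = (2 * ((2 * real CARD('n) + 4) * G2 (x \<bullet> x) + 4 * ((x \<bullet> x) * G3 (x \<bullet> x)))) *\<^sub>R x"
proof -
  have "partial i (partial i \<phi>) x =
     (8 * G3 (x \<bullet> x) * (x $ i * x $ i) + 4 * G2 (x \<bullet> x)) *\<^sub>R x
     + (8 * G2 (x \<bullet> x) * x $ i) *\<^sub>R axis i 1" for i
  proof -
    have "((\<lambda>x. (4 * G2 (x \<bullet> x) * x $ i) *\<^sub>R x + (2 * G1 (x \<bullet> x)) *\<^sub>R axis i 1) has_derivative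
       (\<lambda>h. ((4 * G2 (x \<bullet> x) * x $ i) *\<^sub>R h +
            (4 * G2 (x \<bullet> x) * h $ i + 4 * (2 * G3 (x \<bullet> x) * (x \<bullet> h)) * x $ i) *\<^sub>R x)
            + (2 * (2 * G2 (x \<bullet> x) * (x \<bullet> h))) *\<^sub>R axis i 1)) (at x)"
      by (intro has_derivative_add has_derivative_scaleR has_derivative_ident has_derivative_mult
          has_derivative_mult_right has_derivative_scaleR_left has_derivative_radial G1 G2
          bounded_linear_imp_has_derivative bounded_linear_vec_nth)
    moreover have "partial i \<phi> = (\<lambda>x. (4 * G2 (x \<bullet> x) * x $ i) *\<^sub>R x + (2 * G1 (x \<bullet> x)) *\<^sub>R axis i 1)"
      by (simp add: partial_radial_field fun_eq_iff)
    ultimately show ?thesis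
      by (simp add: partial_eqI inner_axis vec_eq_iff)
  qed
  then have "laplacian \<phi> x = (\<Sum>i\<in>UNIV. (8 * G3 (x \<bullet> x) * (x $ i * x $ i) + 4 * G2 (x \<bullet> x)) *\<^sub>R x)
      + (\<Sum>i\<in>UNIV. (8 * G2 (x \<bullet> x) * x $ i) *\<^sub>R axis i 1)"
    unfolding laplacian_def by (simp add: sum.distrib[symmetric])
  then have "laplacian \<phi> x = (\<Sum>i\<in>UNIV. (8 * G3 (x \<bullet> x) * (x $ i * x $ i) + 4 * G2 (x \<bullet> x))) *\<^sub>R x
      + (8 * G2 (x \<bullet> x)) *\<^sub>R x"
    by (simp only: scaleR_sum_left sum_axis_scaleR)
  also have "(\<Sum>i\<in>UNIV. (8 * G3 (x \<bullet> x) * (x $ i * x $ i) + 4 * G2 (x \<bullet> x)))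
      = 8 * G3 (x \<bullet> x) * (x \<bullet> x) + real CARD('n) * (4 * G2 (x \<bullet> x))"
    by (simp add: sum.distrib sum_distrib_left[symmetric] sum_components)
  finally show ?thesis by (simp add: algebra_simps flip: scaleR_add_left)
qed

end

text \<open>This disposes of the terms in which a divergence free field is paired with a gradient: their
  inner integrals vanish on almost every time slice.\<close>

lemma LINT_AE_zero:
  assumes "AE t in M. (LINT x|N. F x t) = 0"
  shows "(LINT t|M. LINT x|N. F x t * \<eta> t :: real) = 0"
proof -
  have "AE t in M. (LINT x|N. F x t * \<eta> t) = 0" using assms by eventually_elim simp
  then show ?thesis by (rule integral_eq_zero_AE)
qed

text \<open>Here \<open>A x a\<close> is \<open>a \<otimes> a : \<nabla>\<^sup>2\<Psi>\<close> and \<open>\<Delta>\<close> is the Laplacian of \<open>\<Psi>\<close>, for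
  \<open>\<Psi>(x) = G(x \<bullet> x)\<close>.\<close>

lemma radial_test_identity:
  fixes v b f :: "real^'n \<Rightarrow> real \<Rightarrow> real^'n"
  assumes MHD: "MHD_weak_solution \<mu> \<nu> T f g v b p"
    and f: "Lq_time_Lq_loc_sigma 1 T f"
    and \<xi>: "\<xi> C1_differentiable_on UNIV" "compact (supp \<xi>)" "supp \<xi> \<subseteq> {0<..<T}"
    and G: "smooth_real G" "\<forall>s\<ge>R. G s = 0"
    and G1: "\<And>s. (G has_real_derivative G1 s) (at s)"
    and G2: "\<And>s. (G1 has_real_derivative G2 s) (at s)"
  defines "A \<equiv> \<lambda>x a::real^'n. 2 * G1 (x \<bullet> x) * (a \<bullet> a) + 4 * G2 (x \<bullet> x) * ((a \<bullet> x) * (a \<bullet> x))"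
    and "\<Delta> \<equiv> \<lambda>x::real^'n. 2 * real CARD('n) * G1 (x \<bullet> x) + 4 * ((x \<bullet> x) * G2 (x \<bullet> x))"
  shows "- (LINT t|lebesgue_on {0<..<T}. LINT x|lebesgue. A x (v x t) * \<xi> t)
    = - (LINT t|lebesgue_on {0<..<T}. LINT x|lebesgue. A x (b x t) * \<xi> t)
      + (LINT t|lebesgue_on {0<..<T}. LINT x|lebesgue. p x t * \<Delta> x * \<xi> t)
      + 1/2 * (LINT t|lebesgue_on {0<..<T}. LINT x|lebesgue. (norm (b x t))\<^sup>2 * \<Delta> x * \<xi> t)"
proof -
  define \<phi> :: "real^'n \<Rightarrow> real^'n" where "\<phi> = (\<lambda>x. (2 * G1 (x \<bullet> x)) *\<^sub>R x)"
  have s1: "smooth_real G1" using smooth_real_derivative[OF G(1) G1] .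
  have s2: "smooth_real G2" using smooth_real_derivative[OF s1 G2] .
  obtain G3 where G3: "\<And>s. (G2 has_real_derivative G3 s) (at s)"
    using smooth_real_obtain_derivative[OF s2] by blast
  have G1_0: "G1 s = 0" if "s > R" for s
    by (rule DERIV_unique[OF G1 has_field_derivative_transform_within_open[of "\<lambda>_. 0" 0 _ "{R<..}"]])
      (use that G(2) in auto)
  have G2_0: "G2 s = 0" if "s > R" for s
    by (rule DERIV_unique[OF G2 has_field_derivative_transform_within_open[of "\<lambda>_. 0" 0 _ "{R<..}"]])
      (use that G1_0 in auto)
  have "C_k 2 \<phi>"
    unfolding \<phi>_def
    by (rule C_k_scaleR[OF C_k_radial[of "\<lambda>s. 2 * G1 s"] C_k_linear])
      (use s1 in \<open>auto intro: smooth_real_mult smooth_real_const bounded_linear_ident\<close>)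
  moreover have "compact (supp \<phi>)"
    by (rule compact_supp_radial[of "R + 1"]) (simp add: \<phi>_def G1_0)
  ultimately have eq: "- (LINT t|lebesgue_on {0<..<T}. LINT x|lebesgue. v x t \<bullet> \<phi> x * deriv \<xi> t)
        - (LINT t|lebesgue_on {0<..<T}. LINT x|lebesgue.
             tensor (v x t) (v x t) \<bullet> grad_vec \<phi> x * \<xi> t)
        = - (LINT t|lebesgue_on {0<..<T}. LINT x|lebesgue.
               tensor (b x t) (b x t) \<bullet> grad_vec \<phi> x * \<xi> t)
          + (LINT t|lebesgue_on {0<..<T}. LINT x|lebesgue. p x t * divergence \<phi> x * \<xi> t)
          + 1/2 * (LINT t|lebesgue_on {0<..<T}. LINT x|lebesgue.
               (norm (b x t))\<^sup>2 * divergence \<phi> x * \<xi> t)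
          + \<nu> * (LINT t|lebesgue_on {0<..<T}. LINT x|lebesgue. v x t \<bullet> laplacian \<phi> x * \<xi> t)
          + (LINT t|lebesgue_on {0<..<T}. LINT x|lebesgue. f x t \<bullet> \<phi> x * \<xi> t)"
    using MHD \<xi> unfolding MHD_weak_solution_def by blast
  have v_div: "AE t in lebesgue_on {0<..<T}. weakly_div_free (\<lambda>x. v x t)"
    using MHD by (auto simp: MHD_weak_solution_def Lq_time_Lq_loc_sigma_def Lq_loc_sigma_def)
  have f_div: "AE t in lebesgue_on {0<..<T}. weakly_div_free (\<lambda>x. f x t)"
    using f by (auto simp: Lq_time_Lq_loc_sigma_def Lq_loc_sigma_def)
  have \<phi>_0: "(LINT x|lebesgue. u x \<bullet> \<phi> x) = 0" if "weakly_div_free u" for u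
    unfolding \<phi>_def by (rule weakly_div_free_radial[OF that G(1) _ G1]) (use G(2) in auto)
  have lap_0: "(LINT x|lebesgue. u x \<bullet> laplacian \<phi> x) = 0" if "weakly_div_free u" for u
  proof -
    \<comment> \<open>the divergence of \<open>\<phi>\<close> at \<open>x\<close> is \<open>L (x \<bullet> x)\<close>; as \<open>G = 0\<close> on \<open>{R..}\<close> gives \<open>G1 = 0\<close> on the open half-line, it vanishes from \<open>R + 1\<close> on\<close>
    define L where "L s = 2 * real CARD('n) * G1 s + 4 * (s * G2 s)" for s
    define L' where "L' s = (2 * real CARD('n) + 4) * G2 s + 4 * (s * G3 s)" for s
    have "smooth_real L" unfolding L_def[abs_def]
      by (intro smooth_real_add smooth_real_mult smooth_real_const smooth_real_ident s1 s2)
    moreover have "L s = 0" if "s \<ge> R + 1" for s using that by (simp add: L_def G1_0 G2_0)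
    moreover have "(L has_real_derivative L' s) (at s)" for s
      unfolding L_def L'_def
      by (rule DERIV_cong[OF DERIV_add[OF DERIV_cmult[OF G2] DERIV_cmult[OF DERIV_mult[OF DERIV_ident G3]]]])
        (simp add: algebra_simps)
       
    ultimately have "(LINT x|lebesgue. u x \<bullet> ((2 * L' (x \<bullet> x)) *\<^sub>R x)) = 0"
      by (rule weakly_div_free_radial[OF \<open>weakly_div_free u\<close>])
    then show ?thesis by (simp add: \<phi>_def laplacian_radial_field[OF G2 G3] L'_def)
  qed
  have "(LINT t|lebesgue_on {0<..<T}. LINT x|lebesgue. v x t \<bullet> \<phi> x * deriv \<xi> t) = 0"
    by (rule LINT_AE_zero) (use v_div in eventually_elim, rule \<phi>_0)
  moreover have "(LINT t|lebesgue_on {0<..<T}. LINT x|lebesgue. v x t \<bullet> laplacian \<phi> x * \<xi> t) = 0"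
    by (rule LINT_AE_zero) (use v_div in eventually_elim, rule lap_0)
  moreover have "(LINT t|lebesgue_on {0<..<T}. LINT x|lebesgue. f x t \<bullet> \<phi> x * \<xi> t) = 0"
    by (rule LINT_AE_zero) (use f_div in eventually_elim, rule \<phi>_0)
  ultimately show ?thesis
    using eq unfolding A_def \<Delta>_def
    by (simp add: \<phi>_def tensor_inner_grad_radial_field[OF G2] divergence_radial_field[OF G2])
qed

section \<open>Borel representatives on space-time\<close>

text \<open>Time comes first, so that the inner integral of Fubini's theorem runs over space, as in the
  weak formulation.\<close>

abbreviation spacetime :: "(real \<times> (real^'n)) measure" where
  "spacetime \<equiv> lborel \<Otimes>\<^sub>M lborel"

lemma AE_lborel_pair_swap:
  fixes Q :: "'a::euclidean_space \<times> 'b::euclidean_space \<Rightarrow> bool"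
  assumes "AE z in lborel \<Otimes>\<^sub>M lborel. Q z"
  shows "AE z in (lborel :: 'b measure) \<Otimes>\<^sub>M (lborel :: 'a measure). Q (snd z, fst z)"
proof -
  have "AE z in distr ((lborel :: 'b measure) \<Otimes>\<^sub>M (lborel :: 'a measure)) (lborel \<Otimes>\<^sub>M lborel) (\<lambda>(x, y). (y, x)). Q z"
    using assms lborel_pair.distr_pair_swap[where ?'a='a and ?'b='b] by metis
  from AE_distrD[OF measurable_pair_swap' this] show ?thesis
    by (simp add: case_prod_beta')
qed

lemma AE_spacetime_snd:
  assumes "AE x in (lborel :: (real^'n) measure). R x"
  shows "AE z in spacetime. R (snd z)"
proof -
  obtain N where N: "N \<in> null_sets (lborel :: (real^'n) measure)" "{x. \<not> R x} \<subseteq> N"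
    using assms by (auto simp: eventually_ae_filter)
  have [measurable]: "N \<in> sets lborel" using N(1) by auto
  have "AE z in (lborel :: real measure) \<Otimes>\<^sub>M (lborel :: (real^'n) measure). snd z \<notin> N"
  proof (rule lborel_pair.AE_pair_measure)
    show "{z \<in> space ((lborel :: real measure) \<Otimes>\<^sub>M (lborel :: (real^'n) measure)). snd z \<notin> N}
        \<in> sets (lborel \<Otimes>\<^sub>M lborel)" by measurable
  qed (use AE_not_in[OF N(1)] in auto)
  then show ?thesis by eventually_elim (use N(2) in auto)
qed

lemma borel_representative:
  fixes g :: "'a \<Rightarrow> 'b::euclidean_space"
  assumes "g \<in> borel_measurable (completion M)"
  obtains g' where "g' \<in> borel_measurable M" "AE z in M. g z = g' z"
proof -
  have "\<exists>h\<in>borel_measurable M. AE z in M. g z \<bullet> e = h z" for e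
    by (rule completion_ex_borel_measurable_real) (use assms in measurable)
  then have "\<forall>e. \<exists>h. h \<in> borel_measurable M \<and> (AE z in M. g z \<bullet> e = h z)" by blast
  from choice[OF this] obtain h
    where h: "\<And>e. h e \<in> borel_measurable M" "\<And>e. AE z in M. g z \<bullet> e = h e z"
    by blast
  show ?thesis
  proof (rule that)
    show "(\<lambda>z. \<Sum>e\<in>Basis. h e z *\<^sub>R e) \<in> borel_measurable M"
      using h(1) by (auto intro!: borel_measurable_sum borel_measurable_scaleR)
    have "AE z in M. \<forall>e\<in>Basis. g z \<bullet> e = h e z"
      using h(2) by (simp add: AE_finite_all)
    then show "AE z in M. g z = (\<Sum>e\<in>Basis. h e z *\<^sub>R e)"
    proof eventually_elim
      case (elim z)
      have "g z = (\<Sum>e\<in>Basis. (g z \<bullet> e) *\<^sub>R e)" by (simp add: euclidean_representation)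
      then show ?case using elim by simp
    qed
  qed
qed

text \<open>Lebesgue measure on the product is only the completion of a product measure, so Fubini's theorem
  is applied to a Borel function that agrees with \<open>u\<close> almost everywhere on space-time and on
  almost every time slice.\<close>

lemma spacetime_representative:
  fixes u :: "real^'n \<Rightarrow> real \<Rightarrow> 'b::euclidean_space"
  assumes "(\<lambda>z. u (fst z) (snd z)) \<in> borel_measurable (lebesgue_on (UNIV \<times> {0<..<T}))"
  obtains u' where "u' \<in> borel_measurable spacetime"
    "AE z in lborel. snd z \<in> {0<..<T} \<longrightarrow> u (fst z) (snd z) = u' (snd z, fst z)"
    "AE t in lborel. t \<in> {0<..<T} \<longrightarrow> (AE x in lborel. u x t = u' (t, x))"
proof -
  have "open ((UNIV :: (real^'n) set) \<times> {0<..<T})" by (intro open_Times) auto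
  then have S: "(UNIV :: (real^'n) set) \<times> {0<..<T} \<in> sets lebesgue" by auto
  obtain g where g: "g \<in> borel_measurable lborel"
    "AE z in lborel. (if z \<in> UNIV \<times> {0<..<T} then u (fst z) (snd z) else 0) = g z"
    using borel_representative[OF borel_measurable_if_I[OF assms S]] by blast
  define u' where "u' = (\<lambda>z. g (snd z, fst z))"
  have g1: "g \<in> borel_measurable (lborel \<Otimes>\<^sub>M lborel)" using g(1) by (simp add: lborel_prod)
  have "u' \<in> borel_measurable spacetime"
    unfolding u'_def by (rule measurable_compose[OF _ g1]) measurable
  moreover have "AE z in lborel. snd z \<in> {0<..<T} \<longrightarrow> u (fst z) (snd z) = u' (snd z, fst z)"
    using g(2) by eventually_elim (auto simp: u'_def)
  moreover have "AE t in lborel. t \<in> {0<..<T} \<longrightarrow> (AE x in lborel. u x t = u' (t, x))"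
  proof -
    have "AE z in (lborel :: (real^'n) measure) \<Otimes>\<^sub>M (lborel :: real measure).
        snd z \<in> {0<..<T} \<longrightarrow> u (fst z) (snd z) = g z"
      unfolding lborel_prod using g(2) by eventually_elim auto
    from lborel_pair.AE_pair[OF AE_lborel_pair_swap[OF this]]
    show ?thesis by eventually_elim (auto simp: u'_def)
  qed
  ultimately show ?thesis by (rule that)
qed

text \<open>Completeness of Lebesgue measure makes \<open>f\<close> measurable.\<close>

lemma LINT_lebesgue_cong_lborel:
  fixes f g :: "'a::euclidean_space \<Rightarrow> real"
  assumes "g \<in> borel_measurable lborel" "AE x in lborel. f x = g x"
  shows "(LINT x|lebesgue. f x) = (LINT x|lborel. g x)"
proof -
  have g: "g \<in> borel_measurable lebesgue" using assms(1) by (simp add: measurable_completion)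
  have ae: "AE x in lebesgue. g x = f x" using AE_completion[OF assms(2)] by eventually_elim simp
  have "(LINT x|lebesgue. f x) = (LINT x|lebesgue. g x)"
    by (rule integral_cong_AE[OF borel_measurable_AE[OF g ae] g]) (use ae in eventually_elim, simp)
  then show ?thesis by (simp add: integral_completion[OF assms(1)])
qed

text \<open>The iterated integrals of the weak formulation are total functions of arbitrary integrands; this
  identifies them with genuine integrals over space-time.\<close>

lemma iterated_integral_eq:
  fixes F :: "real^'n \<Rightarrow> real \<Rightarrow> real"
  assumes "integrable spacetime F'"
    and "AE t in lborel. t \<in> {0<..<T} \<longrightarrow> (AE x in lborel. F x t = F' (t, x))"
    and "\<And>t x. t \<notin> {0<..<T} \<Longrightarrow> F' (t, x) = 0"
  shows "(LINT t|lebesgue_on {0<..<T}. LINT x|lebesgue. F x t) = (LINT z|spacetime. F' z)"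
proof -
  have meas[measurable]: "F' \<in> borel_measurable spacetime" using assms(1) by auto
  have "(LINT t|lebesgue_on {0<..<T}. LINT x|lebesgue. F x t)
      = (LINT t|lebesgue. indicator {0<..<T} t *\<^sub>R (LINT x|lebesgue. F x t))"
    by (rule integral_restrict_space) auto
  also have "\<dots> = (LINT t|lborel. LINT x|lborel. F' (t, x))"
  proof (rule LINT_lebesgue_cong_lborel)
    show "(\<lambda>t. LINT x|lborel. F' (t, x)) \<in> borel_measurable lborel" by measurable
    show "AE t in lborel. indicator {0<..<T} t *\<^sub>R (LINT x|lebesgue. F x t) = (LINT x|lborel. F' (t, x))"
      using assms(2)
    proof eventually_elim
      case (elim t)
      show ?case
      proof (cases "t \<in> {0<..<T}")
        case True
        then have "(LINT x|lebesgue. F x t) = (LINT x|lborel. F' (t, x))"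
          by (intro LINT_lebesgue_cong_lborel) (use elim in \<open>auto intro: measurable_compose[OF _ meas]\<close>)
        then show ?thesis using True by simp
      qed (simp add: assms(3))
    qed
  qed
  also have "\<dots> = (LINT z|spacetime. F' z)" by (rule lborel_pair.integral_fst'[OF assms(1)])
  finally show ?thesis .
qed

section \<open>Integration against the weight\<close>

locale weighted_density =
  fixes E :: "real \<times> (real^'n) \<Rightarrow> real" and k :: "real^'n \<Rightarrow> real" and T :: real
  assumes integrable_weight: "integrable spacetime (\<lambda>z. indicator {0<..<T} (fst z) * (E z * k (snd z)))"
begin

definition admissible :: "(real \<Rightarrow> real) \<Rightarrow> bool" where
  "admissible \<xi> \<longleftrightarrow> \<xi> \<in> borel_measurable borel \<and> (\<exists>B. \<forall>t. \<bar>\<xi> t\<bar> \<le> B) \<and> (\<forall>t. t \<notin> {0<..<T} \<longrightarrow> \<xi> t = 0)"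

lemma weighted_bound:
  assumes "\<bar>q\<bar> \<le> E (t, x)" "\<bar>c\<bar> \<le> C * k x" "\<bar>y\<bar> \<le> B"
  shows "\<bar>c * q * y\<bar> \<le> B * C * (E (t, x) * k x)"
proof -
  have "\<bar>c * q * y\<bar> = \<bar>c\<bar> * \<bar>q\<bar> * \<bar>y\<bar>" by (simp add: abs_mult)
  also have "\<dots> \<le> (C * k x) * E (t, x) * B"
    using assms by (intro mult_mono) auto
  finally show ?thesis by (simp add: mult_ac)
qed

lemma
  assumes q: "q \<in> borel_measurable spacetime" "\<And>z. fst z \<in> {0<..<T} \<Longrightarrow> \<bar>q z\<bar> \<le> E z"
    and \<xi>: "admissible \<xi>"
    and c: "\<And>n. c n \<in> borel_measurable borel" "\<And>n x. x \<noteq> 0 \<Longrightarrow> \<bar>c n x\<bar> \<le> C * k x"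
  shows weighted_integrable: "\<And>n. integrable spacetime (\<lambda>z. c n (snd z) * q z * \<xi> (fst z))"
    and weighted_tendsto: "c' \<in> borel_measurable borel \<Longrightarrow> AE x in lborel. (\<lambda>n. c n x) \<longlonglongrightarrow> c' x \<Longrightarrow>
      (\<lambda>n. LINT z|spacetime. c n (snd z) * q z * \<xi> (fst z)) \<longlonglongrightarrow>
      (LINT z|spacetime. c' (snd z) * q z * \<xi> (fst z))"
proof -
  obtain B where B: "\<And>t. \<bar>\<xi> t\<bar> \<le> B" and \<xi>0: "\<And>t. t \<notin> {0<..<T} \<Longrightarrow> \<xi> t = 0"
    using \<xi> unfolding admissible_def by blast
  have [measurable]: "\<xi> \<in> borel_measurable borel" "c n \<in> borel_measurable borel" "q \<in> borel_measurable spacetime" for n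
    using \<xi> c q unfolding admissible_def by auto
  have meas: "(\<lambda>z. c n (snd z) * q z * \<xi> (fst z)) \<in> borel_measurable spacetime" for n
    by measurable
  have int: "integrable spacetime (\<lambda>z. B * C * (indicator {0<..<T} (fst z) * (E z * k (snd z))))"
    by (intro integrable_mult_right integrable_weight)
  have "AE z in spacetime. snd z \<noteq> (0 :: real^'n)"
    by (rule AE_spacetime_snd) (rule AE_lborel_singleton)
  then have bound: "AE z in spacetime. norm (c n (snd z) * q z * \<xi> (fst z))
      \<le> B * C * (indicator {0<..<T} (fst z) * (E z * k (snd z)))" for n
  proof eventually_elim
    case (elim z)
    show ?case
    proof (cases "fst z \<in> {0<..<T}")
      case True
      then show ?thesis
        using weighted_bound[of "q z" "fst z" "snd z" "c n (snd z)" C "\<xi> (fst z)" B] q(2)[of z] c(2)[OF elim, of n] B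
        by simp
    qed (simp add: \<xi>0)
  qed
  show "integrable spacetime (\<lambda>z. c n (snd z) * q z * \<xi> (fst z))" for n
    by (rule Bochner_Integration.integrable_bound[OF int meas])
      (use bound in \<open>eventually_elim, auto intro: order_trans[OF _ abs_ge_self]\<close>)
  show "(\<lambda>n. LINT z|spacetime. c n (snd z) * q z * \<xi> (fst z)) \<longlonglongrightarrow>
      (LINT z|spacetime. c' (snd z) * q z * \<xi> (fst z))"
    if [measurable]: "c' \<in> borel_measurable borel" and lim: "AE x in lborel. (\<lambda>n. c n x) \<longlonglongrightarrow> c' x"
  proof (rule integral_dominated_convergence[OF _ meas int _ bound])
    show "(\<lambda>z. c' (snd z) * q z * \<xi> (fst z)) \<in> borel_measurable spacetime" by measurable
    show "AE z in spacetime. (\<lambda>n. c n (snd z) * q z * \<xi> (fst z)) \<longlonglongrightarrow> c' (snd z) * q z * \<xi> (fst z)"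
      using AE_spacetime_snd[OF lim] by eventually_elim (intro tendsto_intros)
  qed
qed

end

text \<open>The squares of the positive parts make the function continuously differentiable.\<close>

definition time_test :: "real \<Rightarrow> real \<Rightarrow> real \<Rightarrow> real" where
  "time_test T \<delta> t = (max 0 (t - \<delta>))\<^sup>2 * (max 0 (T - \<delta> - t))\<^sup>2"

lemma DERIV_max_0_square: "((\<lambda>s. (max 0 s)\<^sup>2) has_real_derivative 2 * max 0 s) (at s)" for s :: real
proof -
  consider "s > 0" | "s < 0" | "s = 0" by linarith
  then show ?thesis
  proof cases
    case 1
    have "((\<lambda>s. s\<^sup>2) has_real_derivative 2 * max 0 s) (at s)"
      using 1 by (auto intro!: derivative_eq_intros)
    then show ?thesis
      by (rule has_field_derivative_transform_within_open[of _ _ _ "{0<..}"]) (use 1 in auto)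
  next
    case 2
    have "((\<lambda>s. 0) has_real_derivative 2 * max 0 s) (at s)"
      using 2 by (auto intro!: derivative_eq_intros)
    then show ?thesis
      by (rule has_field_derivative_transform_within_open[of _ _ _ "{..<0}"]) (use 2 in auto)
  next
    case 3
    have "((\<lambda>h. (max 0 h)\<^sup>2 / h) \<longlongrightarrow> 0) (at (0::real))"
    proof (rule Lim_null_comparison)
      show "\<forall>\<^sub>F h in at (0::real). norm ((max 0 h)\<^sup>2 / h) \<le> \<bar>h\<bar>"
        by (auto simp: eventually_at_filter max_def power2_eq_square)
      show "((\<lambda>h::real. \<bar>h\<bar>) \<longlongrightarrow> 0) (at 0)" by (rule tendsto_rabs_zero) (rule tendsto_ident_at)
    qed
    then show ?thesis using 3 by (simp add: DERIV_def)
  qed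
qed

lemma time_test_properties:
  assumes "\<delta> > 0"
  shows "time_test T \<delta> C1_differentiable_on UNIV" "compact (supp (time_test T \<delta>))"
    "supp (time_test T \<delta>) \<subseteq> {0<..<T}"
proof -
  define D where "D t = 2 * max 0 (t - \<delta>) * (max 0 (T - \<delta> - t))\<^sup>2
      - (max 0 (t - \<delta>))\<^sup>2 * (2 * max 0 (T - \<delta> - t))" for t
  have "((\<lambda>t. t - \<delta>) has_real_derivative 1) (at t)" "((\<lambda>t. T - \<delta> - t) has_real_derivative - 1) (at t)" for t
    by (auto intro!: derivative_eq_intros)
  note d = this[THEN DERIV_chain2[OF DERIV_max_0_square]]
  have "(time_test T \<delta> has_real_derivative D t) (at t)" for t
    unfolding time_test_def[abs_def]
    by (rule DERIV_cong[OF DERIV_mult[OF d]]) (simp add: D_def)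
  moreover have "continuous_on UNIV D" unfolding D_def by (intro continuous_intros)
  ultimately show "time_test T \<delta> C1_differentiable_on UNIV"
    unfolding C1_differentiable_on_def
    by (auto intro!: exI[of _ D] simp: has_real_derivative_iff_has_vector_derivative)
  have "{t. time_test T \<delta> t \<noteq> 0} \<subseteq> {\<delta>..T - \<delta>}" by (auto simp: time_test_def)
  then have "supp (time_test T \<delta>) \<subseteq> {\<delta>..T - \<delta>}" unfolding supp_def by (rule closure_minimal) simp
  then show "compact (supp (time_test T \<delta>))" "supp (time_test T \<delta>) \<subseteq> {0<..<T}"
    using assms by (auto simp: compact_eq_bounded_closed supp_def intro: bounded_subset[OF bounded_closed_interval])
qed

lemma time_test_bounds:
  assumes "\<delta> > 0"
  shows "0 \<le> time_test T \<delta> t" "time_test T \<delta> t \<le> T\<^sup>2 * T\<^sup>2" "t \<notin> {0<..<T} \<Longrightarrow> time_test T \<delta> t = 0"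
    "\<delta> < t \<Longrightarrow> t < T - \<delta> \<Longrightarrow> 0 < time_test T \<delta> t"
proof -
  show "0 \<le> time_test T \<delta> t" by (simp add: time_test_def)
  show 0: "time_test T \<delta> t = 0" if "t \<notin> {0<..<T}"
    using that assms by (auto simp: time_test_def)
  show "time_test T \<delta> t \<le> T\<^sup>2 * T\<^sup>2"
  proof (cases "t \<in> {0<..<T}")
    case True
    then show ?thesis unfolding time_test_def
      by (intro mult_mono power_mono) (use assms in auto)
  qed (simp add: 0)
qed (simp add: time_test_def)

lemma measurable_time_test: "time_test T \<delta> \<in> borel_measurable borel"
  unfolding time_test_def[abs_def] by (intro borel_measurable_continuous_onI continuous_intros)

section \<open>The limiting identity and its sign\<close>

text \<open>The origin gets the value 0: the weights are controlled only on the positive half-line, and a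
  single point does not affect the integrals.\<close>

definition radial_extension :: "(real \<Rightarrow> real) \<Rightarrow> real^'n \<Rightarrow> real" where
  "radial_extension h x = (if x = 0 then 0 else h (norm x))"

lemma measurable_radial_extension:
  assumes "h \<in> borel_measurable (restrict_space borel {0<..})"
  shows "(radial_extension h :: real^'n \<Rightarrow> real) \<in> borel_measurable borel"
proof -
  have "(\<lambda>r. if r \<in> {0<..} then h r else 0) \<in> borel_measurable borel"
    using assms by (subst (asm) measurable_restrict_space_iff[where c=0]) auto
  then have "(\<lambda>x::real^'n. if norm x \<in> {0<..} then h (norm x) else 0) \<in> borel_measurable borel"
    by (rule measurable_compose[rotated]) simp
  moreover have "(\<lambda>x::real^'n. if norm x \<in> {0<..} then h (norm x) else 0) = radial_extension h"
    by (auto simp: radial_extension_def)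
  ultimately show ?thesis by simp
qed

context radial_weight
begin

lemma measurable_w: "w \<in> borel_measurable (restrict_space borel {0<..})"
proof -
  have "mono_on {0<..} (\<lambda>r. - w r)" by (auto intro!: mono_onI antimono)
  from borel_measurable_uminus[OF borel_measurable_mono_on_fnc[OF this]] show ?thesis by simp
qed

lemma continuous_on_positive:
  assumes "\<And>R. continuous_on {0..R} (h :: real \<Rightarrow> real)"
  shows "continuous_on {0<..} h"
proof (rule continuous_at_imp_continuous_on, rule ballI)
  fix r :: real assume "r \<in> {0<..}"
  then show "isCont h r"
    by (intro continuous_on_interior[OF assms[of "r + 1"]]) simp
qed

lemma continuous_on_\<Phi>: "continuous_on {0..R} \<Phi>"
proof -
  have "\<Phi> r = integral {0..r} W" for r
    unfolding \<Phi>_def by (rule set_lebesgue_integral_eq_integral(2)[OF set_integrable_W])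
  then show ?thesis
    by (simp add: indefinite_integral_continuous_1 integrable_continuous_real continuous_on_W)
qed

lemma measurable_W: "W \<in> borel_measurable (restrict_space borel {0<..})"
  and measurable_\<Phi>: "\<Phi> \<in> borel_measurable (restrict_space borel {0<..})"
  by (auto intro!: borel_measurable_continuous_on_restrict continuous_on_positive
      continuous_on_W continuous_on_\<Phi>)

lemma measurable_radial_weights:
  shows "(radial_extension K :: real^'n \<Rightarrow> real) \<in> borel_measurable borel"
    and "(radial_extension (\<lambda>r. 1 / r * W r) :: real^'n \<Rightarrow> real) \<in> borel_measurable borel"
    and "(radial_extension (\<lambda>r. w r - 1 / r * W r) :: real^'n \<Rightarrow> real) \<in> borel_measurable borel"
proof -
  note [measurable] = measurable_w measurable_W measurable_\<Phi>
  have [measurable]: "(\<lambda>r. r) \<in> borel_measurable (restrict_space borel {0<..})"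
    by (intro measurable_restrict_space1) simp
  show "(radial_extension K :: real^'n \<Rightarrow> real) \<in> borel_measurable borel"
    by (intro measurable_radial_extension) (simp add: K_def[abs_def])
  show "(radial_extension (\<lambda>r. 1 / r * W r) :: real^'n \<Rightarrow> real) \<in> borel_measurable borel"
    by (intro measurable_radial_extension) simp
  show "(radial_extension (\<lambda>r. w r - 1 / r * W r) :: real^'n \<Rightarrow> real) \<in> borel_measurable borel"
    by (intro measurable_radial_extension) simp
qed

lemma AE_norm_not_in_D: "AE x in (lborel :: (real^'n) measure). norm x \<notin> D"
proof -
  have "negligible (\<Union>r\<in>D. sphere (0::real^'n) r)"
    by (intro negligible_countable_Union) (auto intro: countable_D negligible_sphere)
  then have "AE x in lebesgue. x \<notin> (\<Union>r\<in>D. sphere (0::real^'n) r)"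
    by (intro AE_not_in) (simp add: negligible_iff_null_sets)
  then show ?thesis by (simp add: AE_completion_iff)
qed

end

text \<open>The inequalities behind the theorem, for the matrix with eigenvalue \<open>\<omega>\<close> in the direction \<open>e\<close>
  and \<open>\<alpha>\<close> orthogonally to it; its trace is \<open>N \<alpha> + (\<omega> - \<alpha>)\<close>. In the second one the terms of
  \<open>\<alpha>\<close> add up to \<open>(N - 3)/2 \<alpha> |a|\<^sup>2\<close>, and \<open>- (\<omega> - \<alpha>) (a \<bullet> e)\<^sup>2\<close> is nonnegative.\<close>

lemma hessian_forms_lower_bounds:
  fixes \<alpha> \<omega> N :: real and a e :: "'a::real_inner"
  assumes "0 < \<omega>" "\<omega> \<le> \<alpha>" "3 \<le> N" "norm e = 1"
  shows "\<omega> * (a \<bullet> a) \<le> \<alpha> * (a \<bullet> a) + (\<omega> - \<alpha>) * (a \<bullet> e)\<^sup>2"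
    and "\<omega> / 2 * (a \<bullet> a) \<le> (N * \<alpha> + (\<omega> - \<alpha>)) / 2 * (a \<bullet> a) - \<alpha> * (a \<bullet> a) - (\<omega> - \<alpha>) * (a \<bullet> e)\<^sup>2"
proof -
  have "(a \<bullet> e)\<^sup>2 \<le> (a \<bullet> a) * (e \<bullet> e)" by (rule Cauchy_Schwarz_ineq)
  then have cs: "(a \<bullet> e)\<^sup>2 \<le> a \<bullet> a" using assms(4) by (simp add: dot_square_norm)
  have "(\<alpha> - \<omega>) * (a \<bullet> e)\<^sup>2 \<le> (\<alpha> - \<omega>) * (a \<bullet> a)"
    using cs assms by (intro mult_left_mono) auto
  then show "\<omega> * (a \<bullet> a) \<le> \<alpha> * (a \<bullet> a) + (\<omega> - \<alpha>) * (a \<bullet> e)\<^sup>2" by (simp add: algebra_simps)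
  have "0 \<le> (N - 3) / 2 * \<alpha> * (a \<bullet> a)" "0 \<le> (\<alpha> - \<omega>) * (a \<bullet> e)\<^sup>2" using assms by auto
  then show "\<omega> / 2 * (a \<bullet> a) \<le> (N * \<alpha> + (\<omega> - \<alpha>)) / 2 * (a \<bullet> a) - \<alpha> * (a \<bullet> a) - (\<omega> - \<alpha>) * (a \<bullet> e)\<^sup>2"
    by (simp add: field_simps)
qed

lemma square_inner_sgn_le: "(a \<bullet> sgn x)\<^sup>2 \<le> (norm a)\<^sup>2" for a x :: "real^'n"
proof -
  have "\<bar>a \<bullet> sgn x\<bar> \<le> norm a * norm (sgn x)" by (rule Cauchy_Schwarz_ineq2)
  also have "\<dots> \<le> norm a * 1" by (intro mult_left_mono) (auto simp: norm_sgn)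
  finally show ?thesis by (simp add: abs_le_square_iff[symmetric])
qed

locale borel_fields = radial_weight w + weighted_density E "radial_extension K" T
  for w and E :: "real \<times> (real^'n) \<Rightarrow> real" and T +
  fixes v b :: "real \<times> (real^'n) \<Rightarrow> real^'n" and p :: "real \<times> (real^'n) \<Rightarrow> real"
  assumes v_meas[measurable]: "v \<in> borel_measurable spacetime"
    and b_meas[measurable]: "b \<in> borel_measurable spacetime"
    and p_meas[measurable]: "p \<in> borel_measurable spacetime"
    and E_def: "\<And>z. E z = (norm (v z))\<^sup>2 + (norm (b z))\<^sup>2 + \<bar>p z\<bar>"
begin

text \<open>The squares of the radial components of \<open>v\<close> and \<open>b\<close>.\<close>

definition vr where "vr z = (v z \<bullet> sgn (snd z))\<^sup>2"
definition br where "br z = (b z \<bullet> sgn (snd z))\<^sup>2"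

text \<open>The integral of \<open>H : \<nabla>\<^sup>2\<Psi> \<xi>\<close>, where the Hessian of \<open>\<Psi>\<close> is
  \<open>\<alpha> I + \<beta> e \<otimes> e\<close> with \<open>e = x / |x|\<close>. The six terms are kept apart because each of them
  matches a term of the weak formulation and passes to the limit on its own.\<close>

definition stress_functional :: "(real^'n \<Rightarrow> real) \<Rightarrow> (real^'n \<Rightarrow> real) \<Rightarrow> (real \<Rightarrow> real) \<Rightarrow> real" where
  "stress_functional \<alpha> \<beta> \<xi> =
     (LINT z|spacetime. \<alpha> (snd z) * (v z \<bullet> v z) * \<xi> (fst z))
   + (LINT z|spacetime. \<beta> (snd z) * vr z * \<xi> (fst z))
   - (LINT z|spacetime. \<alpha> (snd z) * (b z \<bullet> b z) * \<xi> (fst z))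
   - (LINT z|spacetime. \<beta> (snd z) * br z * \<xi> (fst z))
   + (LINT z|spacetime. (real CARD('n) * \<alpha> (snd z) + \<beta> (snd z)) * p z * \<xi> (fst z))
   + 1/2 * (LINT z|spacetime. (real CARD('n) * \<alpha> (snd z) + \<beta> (snd z)) * (b z \<bullet> b z) * \<xi> (fst z))"

lemma densities_le_E:
  "\<bar>v z \<bullet> v z\<bar> \<le> E z" "\<bar>vr z\<bar> \<le> E z" "\<bar>b z \<bullet> b z\<bar> \<le> E z" "\<bar>br z\<bar> \<le> E z" "\<bar>p z\<bar> \<le> E z"
  using square_inner_sgn_le[of "v z" "snd z"] square_inner_sgn_le[of "b z" "snd z"]
  by (auto simp: E_def vr_def br_def dot_square_norm add_increasing2 intro: order_trans add_increasing)

lemma densities_measurable[measurable]: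
  "(\<lambda>z. v z \<bullet> v z) \<in> borel_measurable spacetime" "vr \<in> borel_measurable spacetime"
  "(\<lambda>z. b z \<bullet> b z) \<in> borel_measurable spacetime" "br \<in> borel_measurable spacetime"
proof -
  have [measurable]: "(sgn :: real^'n \<Rightarrow> real^'n) \<in> borel_measurable borel"
    unfolding sgn_div_norm[abs_def] by measurable
  show "(\<lambda>z. v z \<bullet> v z) \<in> borel_measurable spacetime" "vr \<in> borel_measurable spacetime"
    "(\<lambda>z. b z \<bullet> b z) \<in> borel_measurable spacetime" "br \<in> borel_measurable spacetime"
    unfolding vr_def[abs_def] br_def[abs_def] by measurable
qed

lemma trace_weight_bound:
  assumes "\<bar>x\<bar> \<le> C * y" "\<bar>z\<bar> \<le> C * y"
  shows "\<bar>real CARD('n) * x + z\<bar> \<le> ((real CARD('n) + 1) * C) * y"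
proof -
  have "\<bar>real CARD('n) * x + z\<bar> \<le> real CARD('n) * \<bar>x\<bar> + \<bar>z\<bar>" by (simp add: abs_mult order_trans[OF abs_triangle_ineq])
  also have "\<dots> \<le> real CARD('n) * (C * y) + C * y" using assms by (intro add_mono mult_left_mono) auto
  finally show ?thesis by (simp add: algebra_simps)
qed

lemma stress_functional_tendsto:
  assumes "admissible \<xi>"
    and "\<And>n. \<alpha> n \<in> borel_measurable borel" "\<And>n x. x \<noteq> 0 \<Longrightarrow> \<bar>\<alpha> n x\<bar> \<le> C * radial_extension K x"
    and "\<And>n. \<beta> n \<in> borel_measurable borel" "\<And>n x. x \<noteq> 0 \<Longrightarrow> \<bar>\<beta> n x\<bar> \<le> C * radial_extension K x"
    and "\<alpha>' \<in> borel_measurable borel" "AE x in lborel. (\<lambda>n. \<alpha> n x) \<longlonglongrightarrow> \<alpha>' x"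
    and "\<beta>' \<in> borel_measurable borel" "AE x in lborel. (\<lambda>n. \<beta> n x) \<longlonglongrightarrow> \<beta>' x"
  shows "(\<lambda>n. stress_functional (\<alpha> n) (\<beta> n) \<xi>) \<longlonglongrightarrow> stress_functional \<alpha>' \<beta>' \<xi>"
proof -
  define \<gamma> where "\<gamma> n x = real CARD('n) * \<alpha> n x + \<beta> n x" for n x
  define \<gamma>' where "\<gamma>' x = real CARD('n) * \<alpha>' x + \<beta>' x" for x
  have \<gamma>: "\<gamma> n \<in> borel_measurable borel" for n unfolding \<gamma>_def[abs_def] using assms(2,4) by measurable
  have \<gamma>': "\<gamma>' \<in> borel_measurable borel" unfolding \<gamma>'_def[abs_def] using assms(6,8) by measurable
  have \<gamma>_le: "\<bar>\<gamma> n x\<bar> \<le> ((real CARD('n) + 1) * C) * radial_extension K x" if "x \<noteq> 0" for n x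
    unfolding \<gamma>_def using assms(3,5)[OF that] by (rule trace_weight_bound)
  have \<gamma>_lim: "AE x in lborel. (\<lambda>n. \<gamma> n x) \<longlonglongrightarrow> \<gamma>' x"
    using assms(7,9) unfolding \<gamma>_def \<gamma>'_def by eventually_elim (intro tendsto_intros)
  note \<alpha>_lim = weighted_tendsto[OF _ _ assms(1) assms(2,3) assms(6,7)]
  note \<beta>_lim = weighted_tendsto[OF _ _ assms(1) assms(4,5) assms(8,9)]
  note \<gamma>_lim = weighted_tendsto[OF _ _ assms(1) \<gamma> \<gamma>_le \<gamma>' \<gamma>_lim]
  show ?thesis
    unfolding stress_functional_def \<gamma>_def[symmetric] \<gamma>'_def[symmetric]
    by (intro tendsto_add tendsto_diff tendsto_mult tendsto_const \<alpha>_lim \<beta>_lim \<gamma>_lim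
        densities_measurable p_meas densities_le_E)
qed

text \<open>The density \<open>S\<close> collects all terms except the pressure. It is nonnegative by
  \<open>hessian_forms_lower_bounds\<close>, and so is the pressure term by hypothesis; as they add up to 0,
  the integral of \<open>S \<xi>\<close> is 0. Time tests that are positive on larger and larger
  parts of \<open>(0, T)\<close> exhaust the interval.\<close>

lemma fields_vanish:
  assumes N: "CARD('n) \<ge> 3"
    and zero: "\<And>\<delta>. \<delta> > 0 \<Longrightarrow> stress_functional (radial_extension (\<lambda>r. 1 / r * W r))
        (radial_extension (\<lambda>r. w r - 1 / r * W r)) (time_test T \<delta>) = 0"
    and pressure: "AE t in lborel. t \<in> {0<..<T} \<longrightarrow>
        0 \<le> (LINT x|lborel. (real CARD('n) * radial_extension (\<lambda>r. 1 / r * W r) x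
            + radial_extension (\<lambda>r. w r - 1 / r * W r) x) * p (t, x))"
  shows "AE z in spacetime. fst z \<in> {0<..<T} \<longrightarrow> v z = 0 \<and> b z = 0"
proof -
  define \<alpha> where "\<alpha> = (radial_extension (\<lambda>r. 1 / r * W r) :: real^'n \<Rightarrow> real)"
  define \<beta> where "\<beta> = (radial_extension (\<lambda>r. w r - 1 / r * W r) :: real^'n \<Rightarrow> real)"
  define \<gamma> where "\<gamma> x = real CARD('n) * \<alpha> x + \<beta> x" for x
  have meas[measurable]: "\<alpha> \<in> borel_measurable borel" "\<beta> \<in> borel_measurable borel"
    unfolding \<alpha>_def \<beta>_def by (rule measurable_radial_weights)+
  have \<gamma>_meas[measurable]: "\<gamma> \<in> borel_measurable borel" unfolding \<gamma>_def[abs_def] by measurable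
  have \<alpha>_le: "\<bar>\<alpha> x\<bar> \<le> 1 * radial_extension K x" and \<beta>_le: "\<bar>\<beta> x\<bar> \<le> 1 * radial_extension K x"
    if "x \<noteq> 0" for x
    using that W_le_K[of "norm x"] W_nonneg[of "norm x"] w_le_average[of "norm x"] pos[of "norm x"]
    by (auto simp: \<alpha>_def \<beta>_def radial_extension_def)
  have \<gamma>_le: "\<bar>\<gamma> x\<bar> \<le> ((real CARD('n) + 1) * 1) * radial_extension K x" if "x \<noteq> 0" for x
    unfolding \<gamma>_def using \<alpha>_le[OF that] \<beta>_le[OF that] by (rule trace_weight_bound)
  define S where "S z = \<alpha> (snd z) * (v z \<bullet> v z) + \<beta> (snd z) * vr z - \<alpha> (snd z) * (b z \<bullet> b z)
     - \<beta> (snd z) * br z + 1/2 * (\<gamma> (snd z) * (b z \<bullet> b z))" for z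
  have S_ge: "\<alpha> x + \<beta> x > 0 \<and> S (t, x) \<ge> (\<alpha> x + \<beta> x) * (v (t, x) \<bullet> v (t, x)) + (\<alpha> x + \<beta> x) / 2 * (b (t, x) \<bullet> b (t, x))"
    if "x \<noteq> 0" for t x
  proof -
    define \<omega> where "\<omega> = w (norm x)"
    have *: "\<alpha> x = 1 / norm x * W (norm x)" "\<beta> x = \<omega> - \<alpha> x"
      using that by (auto simp: \<alpha>_def \<beta>_def \<omega>_def radial_extension_def)
    have \<omega>: "0 < \<omega>" "\<omega> \<le> \<alpha> x" "norm (sgn x) = 1"
      using that pos[of "norm x"] w_le_average[of "norm x"] by (auto simp: \<omega>_def *(1) norm_sgn)
    have "3 \<le> real CARD('n)" using N by simp
    note lb = hessian_forms_lower_bounds[OF \<omega>(1,2) this \<omega>(3)]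
    show ?thesis
      using lb(1)[of "v (t, x)"] lb(2)[of "b (t, x)"] \<omega>(1)
      by (simp add: S_def \<gamma>_def *(2) vr_def br_def)
  qed
  have AE0: "AE z in spacetime. snd z \<noteq> (0 :: real^'n)"
    by (rule AE_spacetime_snd) (rule AE_lborel_singleton)
  have vanish: "AE z in spacetime. time_test T \<delta> (fst z) = 0 \<or> v z = 0 \<and> b z = 0" if "\<delta> > 0" for \<delta>
  proof -
    define \<xi> where "\<xi> = time_test T \<delta>"
    have \<xi>: "admissible \<xi>" "\<And>t. 0 \<le> \<xi> t" "\<And>t. t \<notin> {0<..<T} \<Longrightarrow> \<xi> t = 0"
      using time_test_bounds[OF \<open>\<delta> > 0\<close>] measurable_time_test[of T \<delta>]
      by (auto simp: admissible_def \<xi>_def intro!: exI[of _ "T\<^sup>2 * T\<^sup>2"])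
    have int\<alpha>: "integrable spacetime (\<lambda>z. \<alpha> (snd z) * q z * \<xi> (fst z))"
      if "q \<in> borel_measurable spacetime" "\<And>z. \<bar>q z\<bar> \<le> E z" for q
      by (rule weighted_integrable[where c="\<lambda>_. \<alpha>", OF that(1) that(2) \<xi>(1) meas(1) \<alpha>_le])
    have int\<beta>: "integrable spacetime (\<lambda>z. \<beta> (snd z) * q z * \<xi> (fst z))"
      if "q \<in> borel_measurable spacetime" "\<And>z. \<bar>q z\<bar> \<le> E z" for q
      by (rule weighted_integrable[where c="\<lambda>_. \<beta>", OF that(1) that(2) \<xi>(1) meas(2) \<beta>_le])
    have int\<gamma>: "integrable spacetime (\<lambda>z. \<gamma> (snd z) * q z * \<xi> (fst z))"
      if "q \<in> borel_measurable spacetime" "\<And>z. \<bar>q z\<bar> \<le> E z" for q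
      by (rule weighted_integrable[where c="\<lambda>_. \<gamma>", OF that(1) that(2) \<xi>(1) \<gamma>_meas \<gamma>_le])
    note int = int\<alpha>[OF densities_measurable(1) densities_le_E(1)] int\<beta>[OF densities_measurable(2) densities_le_E(2)]
      int\<alpha>[OF densities_measurable(3) densities_le_E(3)] int\<beta>[OF densities_measurable(4) densities_le_E(4)]
      int\<gamma>[OF densities_measurable(3) densities_le_E(3)]
    have intp: "integrable spacetime (\<lambda>z. \<gamma> (snd z) * p z * \<xi> (fst z))"
      by (intro int\<gamma> p_meas densities_le_E)
    have S_eq: "S z * \<xi> (fst z) = \<alpha> (snd z) * (v z \<bullet> v z) * \<xi> (fst z) + \<beta> (snd z) * vr z * \<xi> (fst z)
      - \<alpha> (snd z) * (b z \<bullet> b z) * \<xi> (fst z) - \<beta> (snd z) * br z * \<xi> (fst z)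
      + 1/2 * (\<gamma> (snd z) * (b z \<bullet> b z) * \<xi> (fst z))" for z
      by (simp add: S_def algebra_simps)
    have intS: "integrable spacetime (\<lambda>z. S z * \<xi> (fst z))"
      unfolding S_eq by (intro Bochner_Integration.integrable_add Bochner_Integration.integrable_diff integrable_mult_right int)
    have sum0: "(LINT z|spacetime. S z * \<xi> (fst z)) + (LINT z|spacetime. \<gamma> (snd z) * p z * \<xi> (fst z)) = 0"
      using zero[OF \<open>\<delta> > 0\<close>] unfolding S_eq stress_functional_def \<alpha>_def[symmetric] \<beta>_def[symmetric] \<gamma>_def[symmetric] \<xi>_def[symmetric]
      by (simp add: int)
    have "0 \<le> (LINT z|spacetime. \<gamma> (snd z) * p z * \<xi> (fst z))"
    proof -
      have "0 \<le> (LINT t|lborel. LINT x|lborel. \<gamma> x * p (t, x) * \<xi> t)"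
      proof (rule integral_nonneg_AE)
        show "AE t in lborel. 0 \<le> (LINT x|lborel. \<gamma> x * p (t, x) * \<xi> t)"
          using pressure[folded \<alpha>_def \<beta>_def, folded \<gamma>_def]
        proof eventually_elim
          case (elim t)
          then show ?case using \<xi>(2,3)[of t]
            by (cases "t \<in> {0<..<T}") auto
        qed
      qed
      also have "\<dots> = (LINT z|spacetime. \<gamma> (snd z) * p z * \<xi> (fst z))"
        using lborel_pair.integral_fst'[OF intp] by simp
      finally show ?thesis .
    qed
    moreover have S_nonneg: "AE z in spacetime. 0 \<le> S z * \<xi> (fst z)"
      using AE0
    proof eventually_elim
      case (elim z)
      have "0 < \<alpha> (snd z) + \<beta> (snd z)" using S_ge[OF elim] by blast
      then have "0 \<le> (\<alpha> (snd z) + \<beta> (snd z)) * (v z \<bullet> v z)"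
        "0 \<le> (\<alpha> (snd z) + \<beta> (snd z)) / 2 * (b z \<bullet> b z)"
        by auto
      then have "0 \<le> S (fst z, snd z)" using conjunct2[OF S_ge[OF elim, of "fst z"]] unfolding prod.collapse by linarith
      then show ?case using \<xi>(2) by simp
    qed
    then have "0 \<le> (LINT z|spacetime. S z * \<xi> (fst z))" by (rule integral_nonneg_AE)
    ultimately have "(LINT z|spacetime. S z * \<xi> (fst z)) = 0" using sum0 by linarith
    then have "AE z in spacetime. S z * \<xi> (fst z) = 0"
      using integral_nonneg_eq_0_iff_AE[OF intS S_nonneg] by simp
    with AE0 show ?thesis
    proof eventually_elim
      case (elim z)
      show ?case
      proof (cases "\<xi> (fst z) = 0")
        case False
        then have "S (fst z, snd z) = 0" using elim by simp
        with S_ge[OF elim(1), of "fst z"]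
        have c: "\<alpha> (snd z) + \<beta> (snd z) > 0"
          and le: "(\<alpha> (snd z) + \<beta> (snd z)) * (v z \<bullet> v z) + (\<alpha> (snd z) + \<beta> (snd z)) / 2 * (b z \<bullet> b z) \<le> 0" by auto
        have "0 \<le> (\<alpha> (snd z) + \<beta> (snd z)) * (v z \<bullet> v z)" "0 \<le> (\<alpha> (snd z) + \<beta> (snd z)) / 2 * (b z \<bullet> b z)"
          using c by auto
        with le have "(\<alpha> (snd z) + \<beta> (snd z)) * (v z \<bullet> v z) = 0" "(\<alpha> (snd z) + \<beta> (snd z)) / 2 * (b z \<bullet> b z) = 0"
          by linarith+
        with c show ?thesis by auto
      qed (simp add: \<xi>_def)
    qed
  qed
  have "AE z in spacetime. \<forall>n. time_test T (1 / Suc n) (fst z) = 0 \<or> v z = 0 \<and> b z = 0"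
    unfolding AE_all_countable by (intro allI vanish) simp
  then show ?thesis
  proof eventually_elim
    case (elim z)
    show ?case
    proof
      assume t: "fst z \<in> {0<..<T}"
      then obtain n where n: "inverse (real (Suc n)) < min (fst z) (T - fst z)"
        using reals_Archimedean[of "min (fst z) (T - fst z)"] by auto
      then have "0 < time_test T (1 / Suc n) (fst z)"
        by (intro time_test_bounds(4)) (auto simp: inverse_eq_divide)
      with elim show "v z = 0 \<and> b z = 0" by (metis less_irrefl)
    qed
  qed
qed


lemma admissible_test:
  assumes "\<xi> C1_differentiable_on UNIV" "compact (supp \<xi>)" "supp \<xi> \<subseteq> {0<..<T}"
  shows "admissible \<xi>"
proof -
  have cont: "continuous_on UNIV \<xi>" by (rule C1_differentiable_imp_continuous_on[OF assms(1)])
  have 0: "\<xi> t = 0" if "t \<notin> supp \<xi>" for t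
    using that closure_subset[of "{t. \<xi> t \<noteq> 0}"] by (auto simp: supp_def)
  have "bounded (\<xi> ` supp \<xi>)"
    by (intro compact_imp_bounded compact_continuous_image continuous_on_subset[OF cont] assms(2)) simp
  then obtain B where B: "\<And>t. t \<in> supp \<xi> \<Longrightarrow> \<bar>\<xi> t\<bar> \<le> B" by (auto simp: bounded_iff)
  have "\<bar>\<xi> t\<bar> \<le> max B 0" for t using B[of t] 0[of t] by (cases "t \<in> supp \<xi>") auto
  moreover have "\<xi> t = 0" if "t \<notin> {0<..<T}" for t using 0 assms(3) that by blast
  moreover have "\<xi> \<in> borel_measurable borel" using cont by (rule borel_measurable_continuous_onI)
  ultimately show ?thesis unfolding admissible_def by blast
qed

lemma stress_functional_radial_test_zero:
  fixes v0 b0 f g :: "real^'n \<Rightarrow> real \<Rightarrow> real^'n" and p0 :: "real^'n \<Rightarrow> real \<Rightarrow> real"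
  assumes MHD: "MHD_weak_solution \<mu> \<nu> T f g v0 b0 p0" "Lq_time_Lq_loc_sigma 1 T f"
    and rep: "AE t in lborel. t \<in> {0<..<T} \<longrightarrow> (AE x in lborel. v0 x t = v (t, x) \<and> b0 x t = b (t, x) \<and> p0 x t = p (t, x))"
    and \<xi>: "\<xi> C1_differentiable_on UNIV" "compact (supp \<xi>)" "supp \<xi> \<subseteq> {0<..<T}"
    and G: "smooth_real G" "\<forall>s\<ge>R. G s = 0"
      "\<And>s. (G has_real_derivative G1 s) (at s)" "\<And>s. (G1 has_real_derivative G2 s) (at s)"
    and bounds: "\<And>r. 0 < r \<Longrightarrow> \<bar>2 * G1 (r\<^sup>2)\<bar> \<le> C * K r" "\<And>r. 0 < r \<Longrightarrow> \<bar>4 * r\<^sup>2 * G2 (r\<^sup>2)\<bar> \<le> C * K r"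
  shows "stress_functional (\<lambda>x. 2 * G1 (x \<bullet> x)) (\<lambda>x. 4 * (x \<bullet> x) * G2 (x \<bullet> x)) \<xi> = 0"
proof -
  define \<alpha> where "\<alpha> x = 2 * G1 (x \<bullet> x)" for x :: "real^'n"
  define \<beta> where "\<beta> x = 4 * (x \<bullet> x) * G2 (x \<bullet> x)" for x :: "real^'n"
  define \<gamma> where "\<gamma> x = real CARD('n) * \<alpha> x + \<beta> x" for x
  have smooth: "smooth_real G1" "smooth_real G2"
    using smooth_real_derivative[OF G(1,3)] smooth_real_derivative[OF _ G(4)] by auto
  have meas_comp: "(\<lambda>x::real^'n. F (x \<bullet> x)) \<in> borel_measurable borel" if "smooth_real F" for F
  proof -
    have "F \<in> borel_measurable borel"
      by (rule borel_measurable_continuous_onI[OF smooth_real_continuous[OF that]])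
    then show ?thesis by measurable
  qed
  have meas[measurable]: "\<alpha> \<in> borel_measurable borel" "\<beta> \<in> borel_measurable borel"
    unfolding \<alpha>_def[abs_def] \<beta>_def[abs_def] using smooth[THEN meas_comp] by measurable
  have \<gamma>_meas[measurable]: "\<gamma> \<in> borel_measurable borel" unfolding \<gamma>_def[abs_def] by measurable
  have \<alpha>_le: "\<bar>\<alpha> x\<bar> \<le> C * radial_extension K x" and \<beta>_le: "\<bar>\<beta> x\<bar> \<le> C * radial_extension K x"
    if "x \<noteq> 0" for x
    using that bounds[of "norm x"] by (auto simp: \<alpha>_def \<beta>_def radial_extension_def dot_square_norm)
  have \<gamma>_le: "\<bar>\<gamma> x\<bar> \<le> ((real CARD('n) + 1) * C) * radial_extension K x" if "x \<noteq> 0" for x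
    unfolding \<gamma>_def using \<alpha>_le[OF that] \<beta>_le[OF that] by (rule trace_weight_bound)
  have adm: "admissible \<xi>" using admissible_test[OF \<xi>] .
  then have \<xi>0: "\<xi> t = 0" if "t \<notin> {0<..<T}" for t using that by (auto simp: admissible_def)
  have int\<alpha>: "integrable spacetime (\<lambda>z. \<alpha> (snd z) * q z * \<xi> (fst z))"
      if "q \<in> borel_measurable spacetime" "\<And>z. \<bar>q z\<bar> \<le> E z" for q
      by (rule weighted_integrable[where c="\<lambda>_. \<alpha>", OF that(1) that(2) adm meas(1) \<alpha>_le])
  have int\<beta>: "integrable spacetime (\<lambda>z. \<beta> (snd z) * q z * \<xi> (fst z))"
      if "q \<in> borel_measurable spacetime" "\<And>z. \<bar>q z\<bar> \<le> E z" for q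
      by (rule weighted_integrable[where c="\<lambda>_. \<beta>", OF that(1) that(2) adm meas(2) \<beta>_le])
  have int\<gamma>: "integrable spacetime (\<lambda>z. \<gamma> (snd z) * q z * \<xi> (fst z))"
      if "q \<in> borel_measurable spacetime" "\<And>z. \<bar>q z\<bar> \<le> E z" for q
      by (rule weighted_integrable[where c="\<lambda>_. \<gamma>", OF that(1) that(2) adm \<gamma>_meas \<gamma>_le])
  note int = int\<alpha>[OF densities_measurable(1) densities_le_E(1)] int\<beta>[OF densities_measurable(2) densities_le_E(2)]
      int\<alpha>[OF densities_measurable(3) densities_le_E(3)] int\<beta>[OF densities_measurable(4) densities_le_E(4)]
      int\<gamma>[OF densities_measurable(3) densities_le_E(3)]
  have intp: "integrable spacetime (\<lambda>z. \<gamma> (snd z) * p z * \<xi> (fst z))"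
    by (intro int\<gamma> p_meas densities_le_E)
  have sq: "(x \<bullet> x) * (a \<bullet> sgn x)\<^sup>2 = (a \<bullet> x) * (a \<bullet> x)" for a x :: "real^'n"
  proof (cases "x = 0")
    case False
    then have "(x \<bullet> x) * (a \<bullet> sgn x)\<^sup>2 = (norm x * (a \<bullet> sgn x))\<^sup>2"
      by (simp add: power_mult_distrib dot_square_norm)
    also have "norm x * (a \<bullet> sgn x) = a \<bullet> x" using False by (simp add: sgn_div_norm)
    finally show ?thesis by (simp add: power2_eq_square)
  qed simp
  have \<beta>_sq: "4 * G2 (x \<bullet> x) * ((a \<bullet> x) * (a \<bullet> x)) = \<beta> x * (a \<bullet> sgn x)\<^sup>2" for a x :: "real^'n"
    unfolding \<beta>_def sq[symmetric] by simp
  have \<gamma>_eq: "2 * real CARD('n) * G1 (x \<bullet> x) + 4 * ((x \<bullet> x) * G2 (x \<bullet> x)) = \<gamma> x" for x :: "real^'n"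
    by (simp add: \<gamma>_def \<alpha>_def \<beta>_def)
  have quadratic: "(LINT t|lebesgue_on {0<..<T}. LINT x|lebesgue.
      (\<alpha> x * (u0 x t \<bullet> u0 x t) + \<beta> x * (u0 x t \<bullet> sgn x)\<^sup>2) * \<xi> t)
      = (LINT z|spacetime. \<alpha> (snd z) * (u z \<bullet> u z) * \<xi> (fst z))
        + (LINT z|spacetime. \<beta> (snd z) * (u z \<bullet> sgn (snd z))\<^sup>2 * \<xi> (fst z))"
    if "integrable spacetime (\<lambda>z. \<alpha> (snd z) * (u z \<bullet> u z) * \<xi> (fst z))"
      "integrable spacetime (\<lambda>z. \<beta> (snd z) * (u z \<bullet> sgn (snd z))\<^sup>2 * \<xi> (fst z))"
      and "AE t in lborel. t \<in> {0<..<T} \<longrightarrow> (AE x in lborel. u0 x t = u (t, x))"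
    for u0 and u :: "real \<times> (real^'n) \<Rightarrow> real^'n"
  proof -
    have "(LINT t|lebesgue_on {0<..<T}. LINT x|lebesgue.
        (\<alpha> x * (u0 x t \<bullet> u0 x t) + \<beta> x * (u0 x t \<bullet> sgn x)\<^sup>2) * \<xi> t)
        = (LINT z|spacetime. \<alpha> (snd z) * (u z \<bullet> u z) * \<xi> (fst z) + \<beta> (snd z) * (u z \<bullet> sgn (snd z))\<^sup>2 * \<xi> (fst z))"
    proof (rule iterated_integral_eq)
      show "AE t in lborel. t \<in> {0<..<T} \<longrightarrow> (AE x in lborel.
          (\<alpha> x * (u0 x t \<bullet> u0 x t) + \<beta> x * (u0 x t \<bullet> sgn x)\<^sup>2) * \<xi> t
          = \<alpha> (snd (t, x)) * (u (t, x) \<bullet> u (t, x)) * \<xi> (fst (t, x))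
            + \<beta> (snd (t, x)) * (u (t, x) \<bullet> sgn (snd (t, x)))\<^sup>2 * \<xi> (fst (t, x)))"
        using that(3)
      proof eventually_elim
        case (elim t)
        show ?case
        proof
          assume "t \<in> {0<..<T}"
          with elim have "AE x in lborel. u0 x t = u (t, x)" by blast
          then show "AE x in lborel.
            (\<alpha> x * (u0 x t \<bullet> u0 x t) + \<beta> x * (u0 x t \<bullet> sgn x)\<^sup>2) * \<xi> t
            = \<alpha> (snd (t, x)) * (u (t, x) \<bullet> u (t, x)) * \<xi> (fst (t, x))
              + \<beta> (snd (t, x)) * (u (t, x) \<bullet> sgn (snd (t, x)))\<^sup>2 * \<xi> (fst (t, x))"
            by eventually_elim (simp add: algebra_simps)
        qed
      qed
    qed (use that(1,2) \<xi>0 in auto)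
    also have "\<dots> = (LINT z|spacetime. \<alpha> (snd z) * (u z \<bullet> u z) * \<xi> (fst z))
        + (LINT z|spacetime. \<beta> (snd z) * (u z \<bullet> sgn (snd z))\<^sup>2 * \<xi> (fst z))"
      by (rule Bochner_Integration.integral_add[OF that(1,2)])
    finally show ?thesis .
  qed
  have trace: "(LINT t|lebesgue_on {0<..<T}. LINT x|lebesgue. q0 x t * \<gamma> x * \<xi> t)
      = (LINT z|spacetime. \<gamma> (snd z) * q z * \<xi> (fst z))"
    if "integrable spacetime (\<lambda>z. \<gamma> (snd z) * q z * \<xi> (fst z))"
      and ae: "AE t in lborel. t \<in> {0<..<T} \<longrightarrow> (AE x in lborel. q0 x t = q (t, x))" for q0 q
  proof (rule iterated_integral_eq[OF that(1)])
    show "AE t in lborel. t \<in> {0<..<T} \<longrightarrow> (AE x in lborel.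
        q0 x t * \<gamma> x * \<xi> t = \<gamma> (snd (t, x)) * q (t, x) * \<xi> (fst (t, x)))"
      using ae
    proof eventually_elim
      case (elim t)
      show ?case
      proof
        assume "t \<in> {0<..<T}"
        with elim have "AE x in lborel. q0 x t = q (t, x)" by blast
        then show "AE x in lborel. q0 x t * \<gamma> x * \<xi> t = \<gamma> (snd (t, x)) * q (t, x) * \<xi> (fst (t, x))"
          by eventually_elim simp
      qed
    qed
  qed (use \<xi>0 in auto)
  have rep_v: "AE t in lborel. t \<in> {0<..<T} \<longrightarrow> (AE x in lborel. v0 x t = v (t, x))"
    and rep_b: "AE t in lborel. t \<in> {0<..<T} \<longrightarrow> (AE x in lborel. b0 x t = b (t, x))"
    and rep_p: "AE t in lborel. t \<in> {0<..<T} \<longrightarrow> (AE x in lborel. p0 x t = p (t, x))"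
    using rep by (eventually_elim, auto)+
  have rep_bb: "AE t in lborel. t \<in> {0<..<T} \<longrightarrow> (AE x in lborel. (norm (b0 x t))\<^sup>2 = b (t, x) \<bullet> b (t, x))"
    using rep_b
  proof eventually_elim
    case (elim t)
    then show ?case by (auto simp: dot_square_norm elim!: eventually_mono)
  qed
  show ?thesis
    using radial_test_identity[OF MHD \<xi> G]
    unfolding \<gamma>_eq \<beta>_sq \<alpha>_def[symmetric] \<beta>_def[symmetric]
      quadratic[OF int(1) int(2)[unfolded vr_def] rep_v] quadratic[OF int(3) int(4)[unfolded br_def] rep_b]
      trace[OF intp rep_p] trace[OF int(5) rep_bb] stress_functional_def \<gamma>_def[symmetric]
      vr_def[symmetric] br_def[symmetric]
    by linarith
qed

text \<open>The bounds on the test functions are uniform in \<open>n\<close>, and they converge except on the countably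
  many spheres whose radius is a discontinuity of \<open>w\<close>; these spheres form a null set.\<close>

lemma stress_functional_limit_zero:
  fixes v0 b0 f g :: "real^'n \<Rightarrow> real \<Rightarrow> real^'n" and p0 :: "real^'n \<Rightarrow> real \<Rightarrow> real"
  assumes MHD: "MHD_weak_solution \<mu> \<nu> T f g v0 b0 p0" "Lq_time_Lq_loc_sigma 1 T f"
    and rep: "AE t in lborel. t \<in> {0<..<T} \<longrightarrow> (AE x in lborel. v0 x t = v (t, x) \<and> b0 x t = b (t, x) \<and> p0 x t = p (t, x))"
    and \<xi>: "\<xi> C1_differentiable_on UNIV" "compact (supp \<xi>)" "supp \<xi> \<subseteq> {0<..<T}"
  shows "stress_functional (radial_extension (\<lambda>r. 1 / r * W r)) (radial_extension (\<lambda>r. w r - 1 / r * W r)) \<xi> = 0"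
proof -
  obtain C G G1 G2 where G: "\<And>n. smooth_real (G n)"
    "\<And>n s. (G n has_real_derivative G1 n s) (at s)"
    "\<And>n s. (G1 n has_real_derivative G2 n s) (at s)"
    "\<And>n s. s \<ge> (real (Suc n))\<^sup>2 \<Longrightarrow> G n s = 0"
    and le: "\<And>n r. 0 < r \<Longrightarrow> \<bar>2 * G1 n (r\<^sup>2)\<bar> \<le> C * K r"
    "\<And>n r. 0 < r \<Longrightarrow> \<bar>4 * r\<^sup>2 * G2 n (r\<^sup>2)\<bar> \<le> C * K r"
    and lim: "\<And>r. 0 < r \<Longrightarrow> (\<lambda>n. 2 * G1 n (r\<^sup>2)) \<longlonglongrightarrow> 1 / r * W r"
    "\<And>r. 0 < r \<Longrightarrow> r \<notin> D \<Longrightarrow> (\<lambda>n. 4 * r\<^sup>2 * G2 n (r\<^sup>2)) \<longlonglongrightarrow> w r - 1 / r * W r"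
    by (rule radial_test_functions) (rule that; assumption)
  define \<alpha> where "\<alpha> n x = 2 * G1 n (x \<bullet> x)" for n and x :: "real^'n"
  define \<beta> where "\<beta> n x = 4 * (x \<bullet> x) * G2 n (x \<bullet> x)" for n and x :: "real^'n"
  have zero: "stress_functional (\<alpha> n) (\<beta> n) \<xi> = 0" for n
    unfolding \<alpha>_def[abs_def] \<beta>_def[abs_def]
    by (rule stress_functional_radial_test_zero[OF MHD rep \<xi> G(1) _ G(2,3) le]) (use G(4) in auto)
  have "G1 n \<in> borel_measurable borel" "G2 n \<in> borel_measurable borel" for n
    using smooth_real_derivative[OF G(1,2), of n] smooth_real_derivative[OF _ G(3), of n]
    by (auto intro: borel_measurable_continuous_onI smooth_real_continuous)
  then have meas: "\<alpha> n \<in> borel_measurable borel" "\<beta> n \<in> borel_measurable borel" for n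
    unfolding \<alpha>_def[abs_def] \<beta>_def[abs_def] by measurable
  have bound: "\<bar>\<alpha> n x\<bar> \<le> C * radial_extension K x" "\<bar>\<beta> n x\<bar> \<le> C * radial_extension K x"
    if "x \<noteq> 0" for n x
    using that le[of "norm x" n] by (auto simp: \<alpha>_def \<beta>_def radial_extension_def dot_square_norm)
  have lims: "AE x in lborel. (\<lambda>n. \<alpha> n x) \<longlonglongrightarrow> radial_extension (\<lambda>r. 1 / r * W r) x"
    "AE x in lborel. (\<lambda>n. \<beta> n x) \<longlonglongrightarrow> radial_extension (\<lambda>r. w r - 1 / r * W r) x"
    using AE_norm_not_in_D
    by (eventually_elim, use lim in \<open>auto simp: \<alpha>_def \<beta>_def radial_extension_def dot_square_norm D_def\<close>)+
  have "(\<lambda>n. stress_functional (\<alpha> n) (\<beta> n) \<xi>) \<longlonglongrightarrow>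
      stress_functional (radial_extension (\<lambda>r. 1 / r * W r)) (radial_extension (\<lambda>r. w r - 1 / r * W r)) \<xi>"
    by (rule stress_functional_tendsto[OF admissible_test[OF \<xi>] meas(1) bound(1) meas(2) bound(2)
        measurable_radial_weights(2) lims(1) measurable_radial_weights(3) lims(2)])
  then show ?thesis unfolding zero by (simp add: LIMSEQ_const_iff)
qed

end

section \<open>The Liouville theorem\<close>

theorem theorem3p1:
  fixes \<mu> \<nu> T :: real
    and w :: "real \<Rightarrow> real"
    and v b f g :: "real^'n \<Rightarrow> real \<Rightarrow> real^'n"
    and p :: "real^'n \<Rightarrow> real \<Rightarrow> real"
  assumes "\<mu> \<ge> 0" and "\<nu> \<ge> 0" and "CARD('n) \<ge> 3" and "T > 0"
    and "L1_loc_halfline w"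
    and "\<And>r. 0 < r \<Longrightarrow> w r > 0"
    and "\<And>r s. 0 < r \<Longrightarrow> r \<le> s \<Longrightarrow> w s \<le> w r"
    and "Lq_time_Lq_loc_sigma 1 T f" and "Lq_time_Lq_loc_sigma 1 T g"
    and "MHD_weak_solution \<mu> \<nu> T f g v b p"
    and "(\<integral>\<^sup>+t. (\<integral>\<^sup>+x. ennreal (((norm (v x t))\<^sup>2 + (norm (b x t))\<^sup>2 + \<bar>p x t\<bar>) *
            (w (norm x)
             + 1 / norm x * (LINT s:{0..norm x}|lebesgue. w s)
             + 1 / (norm x)\<^sup>2 * (LINT r:{0..norm x}|lebesgue. LINT s:{0..r}|lebesgue. w s)))
          \<partial>lebesgue) \<partial>lebesgue_on {0<..<T}) < \<infinity>"
    and "AE t in lebesgue_on {0<..<T}.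
           (LINT x|lebesgue. p x t *
              (w (norm x) + (real CARD('n) - 1) / norm x * (LINT s:{0..norm x}|lebesgue. w s))) \<ge> 0"
  shows "AE z in lebesgue_on (UNIV \<times> {0<..<T}).
           b (fst z) (snd z) = 0 \<and> v (fst z) (snd z) = 0"
proof -
  interpret radial_weight w by standard (use assms(5,6,7) in auto)
  have meas: "(\<lambda>z. v (fst z) (snd z)) \<in> borel_measurable (lebesgue_on (UNIV \<times> {0<..<T}))"
    "(\<lambda>z. b (fst z) (snd z)) \<in> borel_measurable (lebesgue_on (UNIV \<times> {0<..<T}))"
    "(\<lambda>z. p (fst z) (snd z)) \<in> borel_measurable (lebesgue_on (UNIV \<times> {0<..<T}))"
    using assms(10) by (auto simp: MHD_weak_solution_def Lq_time_Lq_loc_sigma_def Lq_time_Lq_loc_def)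
  obtain v' where v': "v' \<in> borel_measurable spacetime"
    "AE z in lborel. snd z \<in> {0<..<T} \<longrightarrow> v (fst z) (snd z) = v' (snd z, fst z)"
    "AE t in lborel. t \<in> {0<..<T} \<longrightarrow> (AE x in lborel. v x t = v' (t, x))"
    by (rule spacetime_representative[OF meas(1)])
  obtain b' where b': "b' \<in> borel_measurable spacetime"
    "AE z in lborel. snd z \<in> {0<..<T} \<longrightarrow> b (fst z) (snd z) = b' (snd z, fst z)"
    "AE t in lborel. t \<in> {0<..<T} \<longrightarrow> (AE x in lborel. b x t = b' (t, x))"
    by (rule spacetime_representative[OF meas(2)])
  obtain p' where p': "p' \<in> borel_measurable spacetime"
    "AE t in lborel. t \<in> {0<..<T} \<longrightarrow> (AE x in lborel. p x t = p' (t, x))"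
    by (rule spacetime_representative[OF meas(3)])
  have rep: "AE t in lborel. t \<in> {0<..<T} \<longrightarrow>
      (AE x in lborel. v x t = v' (t, x) \<and> b x t = b' (t, x) \<and> p x t = p' (t, x))"
    using v'(3) b'(3) p'(2) by eventually_elim auto
  define E where "E z = (norm (v' z))\<^sup>2 + (norm (b' z))\<^sup>2 + \<bar>p' z\<bar>" for z
  define k where "k = (radial_extension K :: real^'n \<Rightarrow> real)"
  have k_meas[measurable]: "k \<in> borel_measurable borel"
    unfolding k_def by (rule measurable_radial_weights)
  have E_meas[measurable]: "E \<in> borel_measurable spacetime"
    unfolding E_def[abs_def] using v'(1) b'(1) p'(1) by measurable
  have AE_nonzero: "AE x in lborel. x \<noteq> (0 :: real^'n)" by (rule AE_lborel_singleton)
  have S: "{0<..<T} \<inter> space lebesgue \<in> sets lebesgue" by simp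

  have "integrable spacetime (\<lambda>z. indicator {0<..<T} (fst z) * (E z * k (snd z)))"
  proof (rule integrableI_bounded)
    show "(\<lambda>z. indicator {0<..<T} (fst z) * (E z * k (snd z))) \<in> borel_measurable spacetime"
      by measurable
    have "0 \<le> K r" if "0 < r" for r using w_le_K[OF that] pos[OF that] by simp
    then have k0: "0 \<le> k x" for x by (simp add: k_def radial_extension_def)
    have E0: "0 \<le> E z" for z by (simp add: E_def)
    have "(\<integral>\<^sup>+z. ennreal (norm (indicator {0<..<T} (fst z) * (E z * k (snd z)))) \<partial>spacetime)
        = (\<integral>\<^sup>+z. ennreal (indicator {0<..<T} (fst z) * (E z * k (snd z))) \<partial>spacetime)"
      using k0 E0 by simp
    also have "\<dots> = (\<integral>\<^sup>+t. \<integral>\<^sup>+x. ennreal (indicator {0<..<T} t * (E (t, x) * k x)) \<partial>lborel \<partial>lborel)"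
      by (subst lborel.nn_integral_fst[symmetric]) auto
    also have "\<dots> = (\<integral>\<^sup>+t. (\<integral>\<^sup>+x. ennreal (((norm (v x t))\<^sup>2 + (norm (b x t))\<^sup>2 + \<bar>p x t\<bar>) *
            K (norm x)) \<partial>lborel) * indicator {0<..<T} t \<partial>lborel)"
    proof (rule nn_integral_cong_AE)
      show "AE t in lborel. (\<integral>\<^sup>+x. ennreal (indicator {0<..<T} t * (E (t, x) * k x)) \<partial>lborel)
        = (\<integral>\<^sup>+x. ennreal (((norm (v x t))\<^sup>2 + (norm (b x t))\<^sup>2 + \<bar>p x t\<bar>) * K (norm x)) \<partial>lborel)
          * indicator {0<..<T} t"
        using rep
      proof eventually_elim
        case (elim t)
        show ?case
        proof (cases "t \<in> {0<..<T}")
          case True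
          with elim have "AE x in lborel. v x t = v' (t, x) \<and> b x t = b' (t, x) \<and> p x t = p' (t, x)"
            by blast
          with AE_nonzero have "AE x in lborel. ennreal (E (t, x) * k x)
            = ennreal (((norm (v x t))\<^sup>2 + (norm (b x t))\<^sup>2 + \<bar>p x t\<bar>) * K (norm x))"
            by eventually_elim (simp add: E_def k_def radial_extension_def)
          then show ?thesis using True by (simp cong: nn_integral_cong_AE)
        qed simp
      qed
    qed
    also have "\<dots> = (\<integral>\<^sup>+t. (\<integral>\<^sup>+x. ennreal (((norm (v x t))\<^sup>2 + (norm (b x t))\<^sup>2 + \<bar>p x t\<bar>) *
            K (norm x)) \<partial>lebesgue) \<partial>lebesgue_on {0<..<T})"
      by (simp add: nn_integral_restrict_space[OF S] nn_integral_completion)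
    also have "\<dots> < \<infinity>"
      using assms(11) by (simp only: K_def W_def \<Phi>_def)
    finally show "(\<integral>\<^sup>+z. ennreal (norm (indicator {0<..<T} (fst z) * (E z * k (snd z)))) \<partial>spacetime) < \<infinity>" .
  qed
  then interpret borel_fields w E T v' b' p'
    by unfold_locales (use v'(1) b'(1) p'(1) in \<open>simp_all add: k_def E_def\<close>)

  have pressure: "AE t in lborel. t \<in> {0<..<T} \<longrightarrow>
      0 \<le> (LINT x|lborel. (real CARD('n) * radial_extension (\<lambda>r. 1 / r * W r) x
          + radial_extension (\<lambda>r. w r - 1 / r * W r) x) * p' (t, x))"
  proof -
    have "AE t in lborel. t \<in> {0<..<T} \<longrightarrow> (LINT x|lebesgue. p x t *
        (w (norm x) + (real CARD('n) - 1) / norm x * W (norm x))) \<ge> 0"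
      using assms(12) unfolding AE_restrict_space_iff[OF S] AE_completion_iff W_def .
    then show ?thesis using rep
    proof eventually_elim
      case (elim t)
      show ?case
      proof
        assume t: "t \<in> {0<..<T}"
        have "(LINT x|lebesgue. p x t * (w (norm x) + (real CARD('n) - 1) / norm x * W (norm x)))
          = (LINT x|lborel. (real CARD('n) * radial_extension (\<lambda>r. 1 / r * W r) x
          + radial_extension (\<lambda>r. w r - 1 / r * W r) x) * p' (t, x))"
        proof (rule LINT_lebesgue_cong_lborel)
          note [measurable] = measurable_radial_weights p'(1)
          show "(\<lambda>x. (real CARD('n) * radial_extension (\<lambda>r. 1 / r * W r) x
            + radial_extension (\<lambda>r. w r - 1 / r * W r) x) * p' (t, x)) \<in> borel_measurable lborel"
            by measurable
          have "AE x in lborel. p x t = p' (t, x)" using elim(2) t by auto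
          with AE_nonzero show "AE x in lborel. p x t * (w (norm x) + (real CARD('n) - 1) / norm x * W (norm x))
            = (real CARD('n) * radial_extension (\<lambda>r. 1 / r * W r) x
              + radial_extension (\<lambda>r. w r - 1 / r * W r) x) * p' (t, x)"
            by eventually_elim (simp add: radial_extension_def field_simps)
        qed
        with elim(1) t show "0 \<le> (LINT x|lborel. (real CARD('n) * radial_extension (\<lambda>r. 1 / r * W r) x
          + radial_extension (\<lambda>r. w r - 1 / r * W r) x) * p' (t, x))" by simp
      qed
    qed
  qed
  have "AE z in spacetime. fst z \<in> {0<..<T} \<longrightarrow> v' z = 0 \<and> b' z = 0"
    by (rule fields_vanish[OF assms(3) stress_functional_limit_zero[OF assms(10,8) rep time_test_properties] pressure])
  from AE_lborel_pair_swap[OF this]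
  have "AE z in lborel. snd z \<in> {0<..<T} \<longrightarrow> v' (snd z, fst z) = 0 \<and> b' (snd z, fst z) = 0"
    unfolding lborel_prod fst_conv .
  with v'(2) b'(2)
  have "AE z in lborel. snd z \<in> {0<..<T} \<longrightarrow> b (fst z) (snd z) = 0 \<and> v (fst z) (snd z) = 0"
    by eventually_elim auto
  moreover have "open ((UNIV :: (real^'n) set) \<times> {0<..<T})" by (intro open_Times) auto
  then have S': "((UNIV :: (real^'n) set) \<times> {0<..<T}) \<inter> space lebesgue \<in> sets lebesgue" by auto
  ultimately show ?thesis
    unfolding AE_restrict_space_iff[OF S'] AE_completion_iff mem_Times_iff by simp
qed

end
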